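(* Let $p:\mathcal D\to\mathcal C$ be a functor. Then $\Lambda_p:\mathrm{Bif}(p)\to\mathcal C$, together with $\eta_p:\mathcal D\to\mathrm{Bif}(p)$ (both constructed from the sequent calculus described in the context), is the free bifibration on $p$. That is: $\mathrm{Bif}(p)$ is a category, $\Lambda_p$ is a bifibration, $\eta_p$ is a functor with $\Lambda_p\circ\eta_p=p$, and for every bifibration $q:\mathcal E\to\mathcal C$ and every functor $\theta:\mathcal D\to\mathcal E$ with $q\circ\theta=p$ there is a unique morphism of bifibrations $F:\mathrm{Bif}(p)\to\mathcal E$ over $\mathcal C$ such that $F\circ\eta_p=\theta$.
   Context: Composition is written in diagrammatic order: $fg$ means first $f$, then $g$. Bifibrations. A (cloven) bifibration is a functor $q:\mathcal E\to\mathcal C$ equipped with the following choices. For every $f:A\to B$ in $\mathcal C$ and $S\in\mathcal E$ with $q(S)=A$, an object $f^{+}S$ with $q(f^+S)=B$ and an arrow $f_S:S\to f^+S$ with $q(f_S)=f$ such that for all $g:B\to C$ and $\alpha:S\to T$ with $q(\alpha)=fg$ there is a unique $\beta:f^+S\to T$ with $q(\beta)=g$ and $\alpha=f_S\,\beta$. For every $g:B\to C$ in $\mathcal C$ and $T\in\mathcal E$ with $q(T)=C$, an object $g^{-}T$ with $q(g^-T)=B$ and an arrow $\bar g_T:g^-T\to T$ with $q(\bar g_T)=g$ such that for all $f:A\to B$ and $\alpha:S\to T$ with $q(\alpha)=fg$ there is a unique $\beta:S\to g^-T$ with $q(\beta)=f$ and $\alpha=\beta\,\bar g_T$. A morphism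 of bifibrations over $\mathcal C$ is a functor commuting with the functors to $\mathcal C$ and sending chosen liftings $f_S$, $\bar g_T$ to chosen liftings. The sequent calculus of $p:\mathcal D\to\mathcal C$. Bifibrational formulas $S\sqsubset A$ ("$S$ lies over the object $A$ of $\mathcal C$") are generated inductively: each object $X$ of $\mathcal D$ is an atomic formula $X\sqsubset p(X)$; if $S\sqsubset A$ and $f:A\to B$ then $f^+S\sqsubset B$; if $T\sqsubset C$ and $g:B\to C$ then $g^-T\sqsubset B$ (formal expressions). For $S\sqsubset A$, $T\sqsubset C$ and $h:A\to C$, derivations $\alpha:S\Rightarrow_h T$ are generated inductively by: - each $\delta:X\to Y$ in $\mathcal D$ with $p(\delta)=f$ is a derivation $\delta:X\Rightarrow_f Y$; - if $\alpha:S\Rightarrow_{fg}T$ then $\mathsf L^+_{f,g}(\alpha):f^+S\Rightarrow_g T$; - if $\alpha:S'\Rightarrow_{f'}S$ then $\mathsf R^+_f(\alpha):S'\Rightarrow_{f'f}f^+S$; - if $\alpha:T\Rightarrow_{g'}T'$ then $\mathsf L^-_g(\alpha):g^-T\Rightarrow_{gg'}T'$; - if $\alpha:S\Rightarrow_{fg}T$ then $\mathsf R^-_{f,g}(\alpha):S\Rightarrow_f g^-T$. Permutation equivalence $\sim$ is the least equivalence relation on derivations of each sequent, closed under the four rules above, containing (whenever both sides are valid) $\mathsf R^+_h\mathsf L^-_f\alpha\sim\mathsf L^-_f\mathsf R^+_h\alpha$ ($\alpha$ over $g$); $\mathsf R^+_h\mathsf L^+_{f,g}\alpha\sim\mathsf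 L^+_{f,gh}\mathsf R^+_h\alpha$ ($\alpha$ over $fg$); $\mathsf R^-_{fg,h}\mathsf L^-_f\alpha\sim\mathsf L^-_f\mathsf R^-_{g,h}\alpha$ ($\alpha$ over $gh$); $\mathsf R^-_{g,h}\mathsf L^+_{f,gh}\alpha\sim\mathsf L^+_{f,g}\mathsf R^-_{fg,h}\alpha$ ($\alpha$ over $fgh$). Identities: $\mathrm{id}_X$ is the axiom $\mathrm{id}_X$ of $\mathcal D$; $\mathrm{id}_{f^+S}=\mathsf L^+_{f,\mathrm{id}}\mathsf R^+_f(\mathrm{id}_S)$; $\mathrm{id}_{g^-T}=\mathsf R^-_{\mathrm{id},g}\mathsf L^-_g(\mathrm{id}_T)$. Cut: for $\alpha:S\Rightarrow_g T$ and $\beta:T\Rightarrow_h U$, the derivation $\alpha\cdot\beta:S\Rightarrow_{gh}U$ is defined recursively (uniquely up to $\sim$, and compatibly with $\sim$) by: $\delta\cdot\epsilon=\delta\epsilon$ (composite in $\mathcal D$) on axioms; $\mathsf R^+_f(\alpha)\cdot\mathsf L^+_{f,h}(\beta)=\alpha\cdot\beta$; $\mathsf R^-_{g,f}(\alpha)\cdot\mathsf L^-_f(\beta)=\alpha\cdot\beta$; $\mathsf L^-_f(\alpha)\cdot\beta=\mathsf L^-_f(\alpha\cdot\beta)$; $\mathsf L^+_{f,g}(\alpha)\cdot\beta=\mathsf L^+_{f,gh}(\alpha\cdot\beta)$ ($\beta$ over $h$); $\alpha\cdot\mathsf R^+_f(\beta)=\mathsf R^+_f(\alpha\cdot\beta)$;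 $\alpha\cdot\mathsf R^-_{h,f}(\beta)=\mathsf R^-_{gh,f}(\alpha\cdot\beta)$ ($\alpha$ over $g$). $\mathrm{Bif}(p)$ has formulas as objects; arrows from $S\sqsubset A$ to $T\sqsubset B$ are $\sim$-classes of derivations $S\Rightarrow_f T$ for all $f:A\to B$; identities and composition are given by $\mathrm{id}_S$ and cut. $\Lambda_p$ sends $S\sqsubset A$ to $A$ and a derivation $S\Rightarrow_f T$ to $f$; its chosen liftings are $f_S=\mathsf R^+_f(\mathrm{id}_S):S\to f^+S$ and $\bar g_T=\mathsf L^-_g(\mathrm{id}_T):g^-T\to T$. $\eta_p$ sends $X$ to the atomic formula $X$ and $\delta$ to the axiom $\delta$. *)

theory Defs
  imports Main
begin

section \<open>Categories and functors\<close>

text \<open>Composition is diagrammatic: \<open>f \<cdot> g\<close> is first \<open>f\<close>, then \<open>g\<close>. The components of a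
  category are only meaningful on its objects and arrows (and composition only on composable
  pairs), so all equality of functors is equality on the objects and arrows of the source.\<close>

record ('o, 'a) cat =
  Obj :: "'o set"
  Arr :: "'a set"
  Dom :: "'a \<Rightarrow> 'o"
  Cod :: "'a \<Rightarrow> 'o"
  Idn :: "'o \<Rightarrow> 'a"
  Comp :: "'a \<Rightarrow> 'a \<Rightarrow> 'a"

abbreviation comp_in :: "'a \<Rightarrow> ('o, 'a) cat \<Rightarrow> 'a \<Rightarrow> 'a"  ("(_ \<cdot>\<^bsub>_\<^esub> _)" [71, 0, 70] 70)
  where "f \<cdot>\<^bsub>C\<^esub> g \<equiv> Comp C f g"

definition Hom :: "('o, 'a) cat \<Rightarrow> 'o \<Rightarrow> 'o \<Rightarrow> 'a set" where
  "Hom C A B = {f \<in> Arr C. Dom C f = A \<and> Cod C f = B}"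

locale category =
  fixes C :: "('o, 'a) cat"
  assumes Dom_Obj: "f \<in> Arr C \<Longrightarrow> Dom C f \<in> Obj C"
    and Cod_Obj: "f \<in> Arr C \<Longrightarrow> Cod C f \<in> Obj C"
    and Idn_Hom: "A \<in> Obj C \<Longrightarrow> Idn C A \<in> Hom C A A"
    and Comp_Hom: "f \<in> Hom C A B \<Longrightarrow> g \<in> Hom C B B' \<Longrightarrow> f \<cdot>\<^bsub>C\<^esub> g \<in> Hom C A B'"
    and Comp_Idn_left: "f \<in> Hom C A B \<Longrightarrow> Idn C A \<cdot>\<^bsub>C\<^esub> f = f"
    and Comp_Idn_right: "f \<in> Hom C A B \<Longrightarrow> f \<cdot>\<^bsub>C\<^esub> Idn C B = f"
    and Comp_assoc: "f \<in> Hom C A B \<Longrightarrow> g \<in> Hom C B B' \<Longrightarrow> h \<in> Hom C B' B'' \<Longrightarrow>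
        (f \<cdot>\<^bsub>C\<^esub> g) \<cdot>\<^bsub>C\<^esub> h = f \<cdot>\<^bsub>C\<^esub> (g \<cdot>\<^bsub>C\<^esub> h)"

record ('x, 'd, 'o, 'a) functr =
  onObj :: "'x \<Rightarrow> 'o"
  onArr :: "'d \<Rightarrow> 'a"

locale cat_functor = D: category D + C: category C
  for D :: "('x, 'd) cat" and C :: "('o, 'a) cat" and F :: "('x, 'd, 'o, 'a) functr" +
  assumes onObj_Obj: "X \<in> Obj D \<Longrightarrow> onObj F X \<in> Obj C"
    and onArr_Hom: "\<delta> \<in> Hom D X Y \<Longrightarrow> onArr F \<delta> \<in> Hom C (onObj F X) (onObj F Y)"
    and onArr_Idn: "X \<in> Obj D \<Longrightarrow> onArr F (Idn D X) = Idn C (onObj F X)"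
    and onArr_Comp: "\<delta> \<in> Hom D X Y \<Longrightarrow> \<epsilon> \<in> Hom D Y Z \<Longrightarrow>
        onArr F (\<delta> \<cdot>\<^bsub>D\<^esub> \<epsilon>) = onArr F \<delta> \<cdot>\<^bsub>C\<^esub> onArr F \<epsilon>"

definition functor_comp ::
    "('o, 'a, 'y, 'e) functr \<Rightarrow> ('x, 'd, 'o, 'a) functr \<Rightarrow> ('x, 'd, 'y, 'e) functr" where
  "functor_comp G F = \<lparr>onObj = onObj G \<circ> onObj F, onArr = onArr G \<circ> onArr F\<rparr>"

definition functor_eq ::
    "('x, 'd) cat \<Rightarrow> ('x, 'd, 'o, 'a) functr \<Rightarrow> ('x, 'd, 'o, 'a) functr \<Rightarrow> bool" where
  "functor_eq D F G \<longleftrightarrow>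
     (\<forall>X\<in>Obj D. onObj F X = onObj G X) \<and> (\<forall>\<delta>\<in>Arr D. onArr F \<delta> = onArr G \<delta>)"


section \<open>Cloven bifibrations\<close>

text \<open>The chosen liftings, for \<open>f : A \<rightarrow> B\<close>, \<open>S\<close> over \<open>A\<close>, \<open>g : B \<rightarrow> C\<close> and \<open>T\<close> over \<open>C\<close>:
  \<open>push f S\<close> is \<open>f\<^sup>+S\<close>, \<open>pushArr f S\<close> is the arrow \<open>S \<rightarrow> f\<^sup>+S\<close>, \<open>pull g T\<close> is \<open>g\<^sup>-T\<close> and
  \<open>pullArr g T\<close> is the arrow \<open>g\<^sup>-T \<rightarrow> T\<close>.\<close>

record ('y, 'e, 'a) cleavage =
  push :: "'a \<Rightarrow> 'y \<Rightarrow> 'y"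
  pushArr :: "'a \<Rightarrow> 'y \<Rightarrow> 'e"
  pull :: "'a \<Rightarrow> 'y \<Rightarrow> 'y"
  pullArr :: "'a \<Rightarrow> 'y \<Rightarrow> 'e"

locale bifibration = cat_functor E C q
  for E :: "('y, 'e) cat" and C :: "('o, 'a) cat" and q :: "('y, 'e, 'o, 'a) functr" +
  fixes K :: "('y, 'e, 'a) cleavage"
  assumes push_Obj: "f \<in> Hom C A B \<Longrightarrow> S \<in> Obj E \<Longrightarrow> onObj q S = A \<Longrightarrow>
        push K f S \<in> Obj E \<and> onObj q (push K f S) = B"
    and pushArr_Hom: "f \<in> Hom C A B \<Longrightarrow> S \<in> Obj E \<Longrightarrow> onObj q S = A \<Longrightarrow>
        pushArr K f S \<in> Hom E S (push K f S) \<and> onArr q (pushArr K f S) = f"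
    and pushArr_universal:
      "f \<in> Hom C A B \<Longrightarrow> S \<in> Obj E \<Longrightarrow> onObj q S = A \<Longrightarrow>
       g \<in> Hom C B B' \<Longrightarrow> \<alpha> \<in> Hom E S T \<Longrightarrow> onArr q \<alpha> = f \<cdot>\<^bsub>C\<^esub> g \<Longrightarrow>
        \<exists>!\<beta>. \<beta> \<in> Hom E (push K f S) T \<and> onArr q \<beta> = g \<and> \<alpha> = pushArr K f S \<cdot>\<^bsub>E\<^esub> \<beta>"
    and pull_Obj: "g \<in> Hom C B B' \<Longrightarrow> T \<in> Obj E \<Longrightarrow> onObj q T = B' \<Longrightarrow>
        pull K g T \<in> Obj E \<and> onObj q (pull K g T) = B"
    and pullArr_Hom: "g \<in> Hom C B B' \<Longrightarrow> T \<in> Obj E \<Longrightarrow> onObj q T = B' \<Longrightarrow>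
        pullArr K g T \<in> Hom E (pull K g T) T \<and> onArr q (pullArr K g T) = g"
    and pullArr_universal:
      "g \<in> Hom C B B' \<Longrightarrow> T \<in> Obj E \<Longrightarrow> onObj q T = B' \<Longrightarrow>
       f \<in> Hom C A B \<Longrightarrow> \<alpha> \<in> Hom E S T \<Longrightarrow> onArr q \<alpha> = f \<cdot>\<^bsub>C\<^esub> g \<Longrightarrow>
        \<exists>!\<beta>. \<beta> \<in> Hom E S (pull K g T) \<and> onArr q \<beta> = f \<and> \<alpha> = \<beta> \<cdot>\<^bsub>E\<^esub> pullArr K g T"

text \<open>Preservation of the chosen objects \<open>f\<^sup>+S\<close> and \<open>g\<^sup>-T\<close> follows from preservation of the
  chosen arrows, by taking codomains and domains.\<close>

locale bifibration_morphism =
    source: bifibration E C q K + target: bifibration E' C q' K' + cat_functor E E' F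
  for E :: "('y, 'e) cat" and E' :: "('z, 'b) cat" and C :: "('o, 'a) cat"
    and q :: "('y, 'e, 'o, 'a) functr" and K :: "('y, 'e, 'a) cleavage"
    and q' :: "('z, 'b, 'o, 'a) functr" and K' :: "('z, 'b, 'a) cleavage"
    and F :: "('y, 'e, 'z, 'b) functr" +
  assumes over_base: "functor_eq E (functor_comp q' F) q"
    and preserves_pushArr: "f \<in> Hom C A B \<Longrightarrow> S \<in> Obj E \<Longrightarrow> onObj q S = A \<Longrightarrow>
        onArr F (pushArr K f S) = pushArr K' f (onObj F S)"
    and preserves_pullArr: "g \<in> Hom C B B' \<Longrightarrow> T \<in> Obj E \<Longrightarrow> onObj q T = B' \<Longrightarrow>
        onArr F (pullArr K g T) = pullArr K' g (onObj F T)"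


section \<open>The sequent calculus of a functor\<close>

text \<open>Raw formulas and raw derivation terms. The formal expressions \<open>f\<^sup>+S\<close> and \<open>g\<^sup>-T\<close> are
  \<open>Push f S\<close> and \<open>Pull g T\<close>; \<open>LP\<close>, \<open>RP\<close>, \<open>LM\<close>, \<open>RM\<close> are the rules
  \<open>L\<^sup>+\<close>, \<open>R\<^sup>+\<close>, \<open>L\<^sup>-\<close>, \<open>R\<^sup>-\<close> with the subscripts they carry.\<close>

datatype ('x, 'a) formula =
    Atom 'x
  | Push 'a "('x, 'a) formula"
  | Pull 'a "('x, 'a) formula"

datatype ('d, 'a) derivation =
    Ax 'd
  | LP 'a 'a "('d, 'a) derivation"
  | RP 'a "('d, 'a) derivation"
  | LM 'a "('d, 'a) derivation"
  | RM 'a 'a "('d, 'a) derivation"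

text \<open>\<open>BArr S f T X\<close> is an arrow \<open>S \<rightarrow> T\<close> of the free bifibration, lying over \<open>f\<close> and given by
  the permutation class \<open>X\<close> of derivations \<open>S \<Rightarrow>\<^sub>f T\<close>.\<close>

datatype ('x, 'd, 'a) bif_arrow =
  BArr (bsrc: "('x, 'a) formula") (bover: 'a) (btgt: "('x, 'a) formula")
    (bcls: "('d, 'a) derivation set")

context
  fixes D :: "('x, 'd) cat" and C :: "('o, 'a) cat" and p :: "('x, 'd, 'o, 'a) functr"
begin

text \<open>\<open>lies_over S A\<close> is \<open>S \<sqsubset> A\<close>.\<close>

inductive lies_over :: "('x, 'a) formula \<Rightarrow> 'o \<Rightarrow> bool" where
  atom: "X \<in> Obj D \<Longrightarrow> lies_over (Atom X) (onObj p X)"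
| push: "lies_over S A \<Longrightarrow> f \<in> Hom C A B \<Longrightarrow> lies_over (Push f S) B"
| pull: "lies_over T B' \<Longrightarrow> g \<in> Hom C B B' \<Longrightarrow> lies_over (Pull g T) B"

primrec base :: "('x, 'a) formula \<Rightarrow> 'o" where
  "base (Atom X) = onObj p X"
| "base (Push f S) = Cod C f"
| "base (Pull g T) = Dom C g"

lemma base_eq: "lies_over S A \<Longrightarrow> base S = A"
  by (induction rule: lies_over.induct) (auto simp: Hom_def)

text \<open>\<open>deriv S h T \<alpha>\<close> is \<open>\<alpha> : S \<Rightarrow>\<^sub>h T\<close>. When \<open>p\<close> is a functor, the formulas of a derivable sequent
  lie over the domain and codomain of \<open>h\<close>, so the rules need no premises of the form \<open>S \<sqsubset> A\<close>.\<close>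

inductive deriv :: "('x, 'a) formula \<Rightarrow> 'a \<Rightarrow> ('x, 'a) formula \<Rightarrow> ('d, 'a) derivation \<Rightarrow> bool" where
  ax: "\<delta> \<in> Hom D X Y \<Longrightarrow> deriv (Atom X) (onArr p \<delta>) (Atom Y) (Ax \<delta>)"
| lp: "f \<in> Hom C A B \<Longrightarrow> g \<in> Hom C B B' \<Longrightarrow> deriv S (f \<cdot>\<^bsub>C\<^esub> g) T \<alpha> \<Longrightarrow>
    deriv (Push f S) g T (LP f g \<alpha>)"
| rp: "f' \<in> Hom C A B \<Longrightarrow> f \<in> Hom C B B' \<Longrightarrow> deriv S' f' S \<alpha> \<Longrightarrow>
    deriv S' (f' \<cdot>\<^bsub>C\<^esub> f) (Push f S) (RP f \<alpha>)"
| lm: "g \<in> Hom C A B \<Longrightarrow> g' \<in> Hom C B B' \<Longrightarrow> deriv T g' T' \<alpha> \<Longrightarrow>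
    deriv (Pull g T) (g \<cdot>\<^bsub>C\<^esub> g') T' (LM g \<alpha>)"
| rm: "f \<in> Hom C A B \<Longrightarrow> g \<in> Hom C B B' \<Longrightarrow> deriv S (f \<cdot>\<^bsub>C\<^esub> g) T \<alpha> \<Longrightarrow>
    deriv S f (Pull g T) (RM f g \<alpha>)"

text \<open>\<open>perm S h T \<alpha> \<beta>\<close> is \<open>\<alpha> \<sim> \<beta>\<close> for derivations of \<open>S \<Rightarrow>\<^sub>h T\<close>.\<close>

inductive perm ::
    "('x, 'a) formula \<Rightarrow> 'a \<Rightarrow> ('x, 'a) formula \<Rightarrow>
     ('d, 'a) derivation \<Rightarrow> ('d, 'a) derivation \<Rightarrow> bool" where
  refl: "deriv S h T \<alpha> \<Longrightarrow> perm S h T \<alpha> \<alpha>"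
| sym: "perm S h T \<alpha> \<beta> \<Longrightarrow> perm S h T \<beta> \<alpha>"
| trans: "perm S h T \<alpha> \<beta> \<Longrightarrow> perm S h T \<beta> \<gamma> \<Longrightarrow> perm S h T \<alpha> \<gamma>"
| cong_lp: "f \<in> Hom C A B \<Longrightarrow> g \<in> Hom C B B' \<Longrightarrow> perm S (f \<cdot>\<^bsub>C\<^esub> g) T \<alpha> \<beta> \<Longrightarrow>
    perm (Push f S) g T (LP f g \<alpha>) (LP f g \<beta>)"
| cong_rp: "f' \<in> Hom C A B \<Longrightarrow> f \<in> Hom C B B' \<Longrightarrow> perm S' f' S \<alpha> \<beta> \<Longrightarrow>
    perm S' (f' \<cdot>\<^bsub>C\<^esub> f) (Push f S) (RP f \<alpha>) (RP f \<beta>)"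
| cong_lm: "g \<in> Hom C A B \<Longrightarrow> g' \<in> Hom C B B' \<Longrightarrow> perm T g' T' \<alpha> \<beta> \<Longrightarrow>
    perm (Pull g T) (g \<cdot>\<^bsub>C\<^esub> g') T' (LM g \<alpha>) (LM g \<beta>)"
| cong_rm: "f \<in> Hom C A B \<Longrightarrow> g \<in> Hom C B B' \<Longrightarrow> perm S (f \<cdot>\<^bsub>C\<^esub> g) T \<alpha> \<beta> \<Longrightarrow>
    perm S f (Pull g T) (RM f g \<alpha>) (RM f g \<beta>)"
| rp_lm: "deriv S k T (RP h (LM f \<alpha>)) \<Longrightarrow> deriv S k T (LM f (RP h \<alpha>)) \<Longrightarrow>
    perm S k T (RP h (LM f \<alpha>)) (LM f (RP h \<alpha>))"
| rp_lp: "deriv S k T (RP h (LP f g \<alpha>)) \<Longrightarrow> deriv S k T (LP f (g \<cdot>\<^bsub>C\<^esub> h) (RP h \<alpha>)) \<Longrightarrow>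
    perm S k T (RP h (LP f g \<alpha>)) (LP f (g \<cdot>\<^bsub>C\<^esub> h) (RP h \<alpha>))"
| rm_lm: "deriv S k T (RM (f \<cdot>\<^bsub>C\<^esub> g) h (LM f \<alpha>)) \<Longrightarrow> deriv S k T (LM f (RM g h \<alpha>)) \<Longrightarrow>
    perm S k T (RM (f \<cdot>\<^bsub>C\<^esub> g) h (LM f \<alpha>)) (LM f (RM g h \<alpha>))"
| rm_lp: "deriv S k T (RM g h (LP f (g \<cdot>\<^bsub>C\<^esub> h) \<alpha>)) \<Longrightarrow>
    deriv S k T (LP f g (RM (f \<cdot>\<^bsub>C\<^esub> g) h \<alpha>)) \<Longrightarrow>
    perm S k T (RM g h (LP f (g \<cdot>\<^bsub>C\<^esub> h) \<alpha>)) (LP f g (RM (f \<cdot>\<^bsub>C\<^esub> g) h \<alpha>))"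

primrec id_deriv :: "('x, 'a) formula \<Rightarrow> ('d, 'a) derivation" where
  "id_deriv (Atom X) = Ax (Idn D X)"
| "id_deriv (Push f S) = LP f (Idn C (Cod C f)) (RP f (id_deriv S))"
| "id_deriv (Pull g T) = RM (Idn C (Dom C g)) g (LM g (id_deriv T))"

text \<open>The recursive clauses for cut overlap and so determine \<open>\<alpha> \<cdot> \<beta>\<close> only up to permutation
  equivalence. They are therefore read as a relation: \<open>cut \<alpha> \<beta> \<gamma>\<close> says that the clauses allow
  \<open>\<gamma>\<close> as a value of \<open>\<alpha> \<cdot> \<beta>\<close>. The relation is used only for \<open>\<alpha> : S \<Rightarrow>\<^sub>g T\<close> and \<open>\<beta> : T \<Rightarrow>\<^sub>h U\<close>.\<close>

inductive cut ::
    "('d, 'a) derivation \<Rightarrow> ('d, 'a) derivation \<Rightarrow> ('d, 'a) derivation \<Rightarrow> bool" where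
  ax_ax: "cut (Ax \<delta>) (Ax \<epsilon>) (Ax (\<delta> \<cdot>\<^bsub>D\<^esub> \<epsilon>))"
| rp_lp: "cut \<alpha> \<beta> \<gamma> \<Longrightarrow> cut (RP f \<alpha>) (LP f h \<beta>) \<gamma>"
| rm_lm: "cut \<alpha> \<beta> \<gamma> \<Longrightarrow> cut (RM g f \<alpha>) (LM f \<beta>) \<gamma>"
| lm_left: "cut \<alpha> \<beta> \<gamma> \<Longrightarrow> cut (LM f \<alpha>) \<beta> (LM f \<gamma>)"
| lp_left: "deriv T h U \<beta> \<Longrightarrow> cut \<alpha> \<beta> \<gamma> \<Longrightarrow> cut (LP f g \<alpha>) \<beta> (LP f (g \<cdot>\<^bsub>C\<^esub> h) \<gamma>)"
| rp_right: "cut \<alpha> \<beta> \<gamma> \<Longrightarrow> cut \<alpha> (RP f \<beta>) (RP f \<gamma>)"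
| rm_right: "deriv S g T \<alpha> \<Longrightarrow> cut \<alpha> \<beta> \<gamma> \<Longrightarrow> cut \<alpha> (RM h f \<beta>) (RM (g \<cdot>\<^bsub>C\<^esub> h) f \<gamma>)"

definition class_of ::
    "('x, 'a) formula \<Rightarrow> 'a \<Rightarrow> ('x, 'a) formula \<Rightarrow> ('d, 'a) derivation \<Rightarrow> ('x, 'd, 'a) bif_arrow" where
  "class_of S h T \<alpha> = BArr S h T {\<beta>. perm S h T \<alpha> \<beta>}"

text \<open>The composite collects every derivation equivalent to some value of \<open>\<alpha> \<cdot> \<beta>\<close>, for any
  representatives \<open>\<alpha>\<close> and \<open>\<beta>\<close>. That this is a single permutation class, i.e. that cut is total,
  unique up to permutation and compatible with it, is part of the claim that \<open>Bif\<close> is a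
  category.\<close>

definition bif_comp ::
    "('x, 'd, 'a) bif_arrow \<Rightarrow> ('x, 'd, 'a) bif_arrow \<Rightarrow> ('x, 'd, 'a) bif_arrow" where
  "bif_comp a b =
     (let S = bsrc a; k = bover a \<cdot>\<^bsub>C\<^esub> bover b; U = btgt b in
      BArr S k U {\<gamma>. \<exists>\<alpha>\<in>bcls a. \<exists>\<beta>\<in>bcls b. \<exists>\<gamma>'. cut \<alpha> \<beta> \<gamma>' \<and> perm S k U \<gamma>' \<gamma>})"

definition Bif :: "(('x, 'a) formula, ('x, 'd, 'a) bif_arrow) cat" where
  "Bif = \<lparr>Obj = {S. \<exists>A. lies_over S A},
          Arr = {class_of S h T \<alpha> | S h T \<alpha>. deriv S h T \<alpha>},
          Dom = bsrc,
          Cod = btgt,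
          Idn = (\<lambda>S. class_of S (Idn C (base S)) S (id_deriv S)),
          Comp = bif_comp\<rparr>"

definition Lambda :: "(('x, 'a) formula, ('x, 'd, 'a) bif_arrow, 'o, 'a) functr" where
  "Lambda = \<lparr>onObj = base, onArr = bover\<rparr>"

definition Bif_cleavage :: "(('x, 'a) formula, ('x, 'd, 'a) bif_arrow, 'a) cleavage" where
  "Bif_cleavage =
     \<lparr>push = Push,
      pushArr = (\<lambda>f S. class_of S f (Push f S) (RP f (id_deriv S))),
      pull = Pull,
      pullArr = (\<lambda>g T. class_of (Pull g T) g T (LM g (id_deriv T)))\<rparr>"

definition eta :: "('x, 'd, ('x, 'a) formula, ('x, 'd, 'a) bif_arrow) functr" where
  "eta = \<lparr>onObj = Atom,
          onArr = (\<lambda>\<delta>. class_of (Atom (Dom D \<delta>)) (onArr p \<delta>) (Atom (Cod D \<delta>)) (Ax \<delta>))\<rparr>"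

end

end

theory Submission
  imports Defs
begin

text \<open>The proof is a cut elimination argument. A raw derivation determines its sequent, so typing
  becomes a predicate \<open>valid\<close> together with functions \<open>src\<close>, \<open>over\<close>, \<open>tgt\<close>, and permutation
  equivalence becomes a relation \<open>\<approx>\<close> on derivations.

  Cut is computed by a function \<open>cut_elim\<close> which fixes a strategy: the left rules at the root of
  the first derivation are permuted out before the right rules at the root of the second, and
  when neither is left the cut is principal or between two axioms. The clause that moves a right
  rule of the second derivation outwards then holds up to permutation equivalence whatever the
  first derivation is (\<open>cut_elim_RP\<close>, \<open>cut_elim_RM\<close>): this uses precisely the four generating
  permutations. It follows that \<open>cut_elim\<close> respects \<open>\<approx>\<close> in both arguments (\<open>cut_elim_peq\<close>), that
  every value of the cut relation is equivalent to that of \<open>cut_elim\<close> (\<open>cut_relation_peq\<close>), and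
  that cut is associative and unital (\<open>cut_elim_assoc\<close>, \<open>cut_id_left\<close>, \<open>cut_id_right\<close>). So \<open>Bif\<close>
  is a category. The rules \<open>L\<^sup>+\<close> and \<open>R\<^sup>-\<close> give the factorisations through the chosen liftings,
  and expanding an identity derivation shows that these are unique (\<open>LP_unique\<close>, \<open>RM_unique\<close>).

  For the universal property a derivation is interpreted in the bifibration \<open>q\<close>: axioms by
  \<open>\<theta>\<close>, \<open>R\<^sup>+\<close> and \<open>L\<^sup>-\<close> by composition with a chosen lifting, \<open>L\<^sup>+\<close> and \<open>R\<^sup>-\<close> by the unique
  factorisation through one. Uniqueness of factorisations makes the interpretation invariant
  under permutation (\<open>interp_peq\<close>) and turns cut into composition (\<open>interp_cut_elim\<close>). Since every
  derivation arises from axioms by composing with and factoring through chosen liftings, any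
  morphism of bifibrations extending \<open>\<theta>\<close> agrees with the interpretation.\<close>


section \<open>Categories and functors in terms of domains and codomains\<close>

context category
begin

lemma Hom_iff: "f \<in> Hom C A B \<longleftrightarrow> f \<in> Arr C \<and> Dom C f = A \<and> Cod C f = B"
  by (simp add: Hom_def)

lemma seq [simp]:
  assumes "f \<in> Arr C" "g \<in> Arr C" "Cod C f = Dom C g"
  shows "f \<cdot>\<^bsub>C\<^esub> g \<in> Arr C" "Dom C (f \<cdot>\<^bsub>C\<^esub> g) = Dom C f" "Cod C (f \<cdot>\<^bsub>C\<^esub> g) = Cod C g"
  using Comp_Hom[of f "Dom C f" "Dom C g" g "Cod C g"] assms by (auto simp: Hom_iff)

lemma seq_assoc [simp]:
  assumes "f \<in> Arr C" "g \<in> Arr C" "h \<in> Arr C" "Cod C f = Dom C g" "Cod C g = Dom C h"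
  shows "(f \<cdot>\<^bsub>C\<^esub> g) \<cdot>\<^bsub>C\<^esub> h = f \<cdot>\<^bsub>C\<^esub> (g \<cdot>\<^bsub>C\<^esub> h)"
  using Comp_assoc[of f "Dom C f" "Dom C g" g "Dom C h" h "Cod C h"] assms by (auto simp: Hom_iff)

lemma Idn_simps [simp]:
  assumes "A \<in> Obj C"
  shows "Idn C A \<in> Arr C" "Dom C (Idn C A) = A" "Cod C (Idn C A) = A"
  using Idn_Hom[OF assms] by (auto simp: Hom_iff)

lemma Idn_left [simp]: "f \<in> Arr C \<Longrightarrow> A = Dom C f \<Longrightarrow> Idn C A \<cdot>\<^bsub>C\<^esub> f = f"
  using Comp_Idn_left[of f "Dom C f" "Cod C f"] by (auto simp: Hom_iff)

lemma Idn_right [simp]: "f \<in> Arr C \<Longrightarrow> A = Cod C f \<Longrightarrow> f \<cdot>\<^bsub>C\<^esub> Idn C A = f"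
  using Comp_Idn_right[of f "Dom C f" "Cod C f"] by (auto simp: Hom_iff)

lemmas [simp] = Dom_Obj Cod_Obj

end

lemma (in cat_functor) onArr_simps [simp]:
  assumes "\<delta> \<in> Arr D"
  shows "onArr F \<delta> \<in> Arr C" "Dom C (onArr F \<delta>) = onObj F (Dom D \<delta>)"
    "Cod C (onArr F \<delta>) = onObj F (Cod D \<delta>)"
  using onArr_Hom[of \<delta> "Dom D \<delta>" "Cod D \<delta>"] assms by (auto simp: Hom_def)

lemma (in cat_functor) onArr_seq:
  assumes "\<delta> \<in> Arr D" "\<epsilon> \<in> Arr D" "Cod D \<delta> = Dom D \<epsilon>"
  shows "onArr F (\<delta> \<cdot>\<^bsub>D\<^esub> \<epsilon>) = onArr F \<delta> \<cdot>\<^bsub>C\<^esub> onArr F \<epsilon>"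
  using onArr_Comp[of \<delta> "Dom D \<delta>" "Cod D \<delta>" \<epsilon> "Cod D \<epsilon>"] assms by (auto simp: Hom_def)


section \<open>The sequent of a derivation\<close>

locale sequent_calculus = cat_functor D C p
  for D :: "('x, 'd) cat" and C :: "('o, 'a) cat" and p :: "('x, 'd, 'o, 'a) functr"
begin

text \<open>A raw derivation determines the sequent \<open>src \<alpha> \<Rightarrow> tgt \<alpha>\<close> over \<open>over \<alpha>\<close> that it can derive.\<close>

primrec src :: "('d, 'a) derivation \<Rightarrow> ('x, 'a) formula" where
  "src (Ax \<delta>) = Atom (Dom D \<delta>)"
| "src (LP f g \<alpha>) = Push f (src \<alpha>)"
| "src (RP f \<alpha>) = src \<alpha>"
| "src (LM g \<alpha>) = Pull g (src \<alpha>)"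
| "src (RM f g \<alpha>) = src \<alpha>"

primrec tgt :: "('d, 'a) derivation \<Rightarrow> ('x, 'a) formula" where
  "tgt (Ax \<delta>) = Atom (Cod D \<delta>)"
| "tgt (LP f g \<alpha>) = tgt \<alpha>"
| "tgt (RP f \<alpha>) = Push f (tgt \<alpha>)"
| "tgt (LM g \<alpha>) = tgt \<alpha>"
| "tgt (RM f g \<alpha>) = Pull g (tgt \<alpha>)"

primrec over :: "('d, 'a) derivation \<Rightarrow> 'a" where
  "over (Ax \<delta>) = onArr p \<delta>"
| "over (LP f g \<alpha>) = g"
| "over (RP f \<alpha>) = over \<alpha> \<cdot>\<^bsub>C\<^esub> f"
| "over (LM g \<alpha>) = g \<cdot>\<^bsub>C\<^esub> over \<alpha>"
| "over (RM f g \<alpha>) = f"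

text \<open>\<open>valid \<alpha>\<close> says that \<open>\<alpha>\<close> derives that sequent; that the formulas lie over the right objects
  is then automatic.\<close>

primrec valid :: "('d, 'a) derivation \<Rightarrow> bool" where
  "valid (Ax \<delta>) \<longleftrightarrow> \<delta> \<in> Arr D"
| "valid (LP f g \<alpha>) \<longleftrightarrow> valid \<alpha> \<and> f \<in> Arr C \<and> g \<in> Arr C \<and> Cod C f = Dom C g \<and>
    over \<alpha> = f \<cdot>\<^bsub>C\<^esub> g"
| "valid (RP f \<alpha>) \<longleftrightarrow> valid \<alpha> \<and> f \<in> Arr C \<and> Cod C (over \<alpha>) = Dom C f"
| "valid (LM g \<alpha>) \<longleftrightarrow> valid \<alpha> \<and> g \<in> Arr C \<and> Cod C g = Dom C (over \<alpha>)"
| "valid (RM f g \<alpha>) \<longleftrightarrow> valid \<alpha> \<and> f \<in> Arr C \<and> g \<in> Arr C \<and> Cod C f = Dom C g \<and>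
    over \<alpha> = f \<cdot>\<^bsub>C\<^esub> g"

lemma over_Arr [simp]: "valid \<alpha> \<Longrightarrow> over \<alpha> \<in> Arr C"
  by (induction \<alpha>) auto

lemma lies_over_src_tgt:
  "valid \<alpha> \<Longrightarrow> lies_over D C p (src \<alpha>) (Dom C (over \<alpha>)) \<and> lies_over D C p (tgt \<alpha>) (Cod C (over \<alpha>))"
  by (induction \<alpha>) (auto intro: lies_over.intros simp: C.Hom_iff D.Dom_Obj D.Cod_Obj)

lemma base_src [simp]: "valid \<alpha> \<Longrightarrow> base C p (src \<alpha>) = Dom C (over \<alpha>)"
  and base_tgt [simp]: "valid \<alpha> \<Longrightarrow> base C p (tgt \<alpha>) = Cod C (over \<alpha>)"
  using lies_over_src_tgt base_eq by fastforce+

lemma deriv_iff: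
  "deriv D C p S h T \<alpha> \<longleftrightarrow> valid \<alpha> \<and> src \<alpha> = S \<and> over \<alpha> = h \<and> tgt \<alpha> = T"
proof
  assume "deriv D C p S h T \<alpha>"
  then show "valid \<alpha> \<and> src \<alpha> = S \<and> over \<alpha> = h \<and> tgt \<alpha> = T"
    by induction (auto simp: C.Hom_iff D.Hom_iff)
next
  have "valid \<alpha> \<Longrightarrow> deriv D C p (src \<alpha>) (over \<alpha>) (tgt \<alpha>) \<alpha>"
    by (induction \<alpha>) (auto intro!: deriv.intros simp: C.Hom_iff D.Hom_iff)
  then show "valid \<alpha> \<and> src \<alpha> = S \<and> over \<alpha> = h \<and> tgt \<alpha> = T \<Longrightarrow> deriv D C p S h T \<alpha>"
    by auto
qed


section \<open>Permutation equivalence\<close>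

text \<open>Permutation equivalence of derivations, at the sequent which they determine.\<close>

definition peq :: "('d, 'a) derivation \<Rightarrow> ('d, 'a) derivation \<Rightarrow> bool"  (infix "\<approx>" 50) where
  "\<alpha> \<approx> \<beta> \<longleftrightarrow> perm D C p (src \<alpha>) (over \<alpha>) (tgt \<alpha>) \<alpha> \<beta>"

lemma perm_deriv: "perm D C p S h T \<alpha> \<beta> \<Longrightarrow> deriv D C p S h T \<alpha> \<and> deriv D C p S h T \<beta>"
  by (induction rule: perm.induct) (auto intro: deriv.intros)

lemma perm_iff: "perm D C p S h T \<alpha> \<beta> \<longleftrightarrow> \<alpha> \<approx> \<beta> \<and> src \<alpha> = S \<and> over \<alpha> = h \<and> tgt \<alpha> = T"
  unfolding peq_def using perm_deriv deriv_iff by metis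

lemma peqD:
  assumes "\<alpha> \<approx> \<beta>"
  shows "valid \<alpha>" "valid \<beta>" "src \<alpha> = src \<beta>" "over \<alpha> = over \<beta>" "tgt \<alpha> = tgt \<beta>"
  using assms perm_deriv[of "src \<alpha>" "over \<alpha>" "tgt \<alpha>" \<alpha> \<beta>] by (auto simp: peq_def deriv_iff)

lemma peq_refl: "valid \<alpha> \<Longrightarrow> \<alpha> \<approx> \<alpha>"
  by (simp add: peq_def perm.refl deriv_iff)

lemma peq_sym: "\<alpha> \<approx> \<beta> \<Longrightarrow> \<beta> \<approx> \<alpha>"
  using perm.sym perm_iff by (metis peqD(3-5))

lemma peq_trans [trans]: "\<alpha> \<approx> \<beta> \<Longrightarrow> \<beta> \<approx> \<gamma> \<Longrightarrow> \<alpha> \<approx> \<gamma>"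
  using perm.trans perm_iff by (metis peqD(3-5))

lemma peq_LP: "\<alpha> \<approx> \<beta> \<Longrightarrow> valid (LP f g \<alpha>) \<Longrightarrow> LP f g \<alpha> \<approx> LP f g \<beta>"
  using perm.cong_lp[of f C "Dom C f" "Dom C g" g "Cod C g" D p "src \<alpha>" "tgt \<alpha>" \<alpha> \<beta>]
  by (simp add: peq_def C.Hom_iff)

lemma peq_RP: "\<alpha> \<approx> \<beta> \<Longrightarrow> valid (RP f \<alpha>) \<Longrightarrow> RP f \<alpha> \<approx> RP f \<beta>"
  using perm.cong_rp[of "over \<alpha>" C "Dom C (over \<alpha>)" "Dom C f" f "Cod C f" D p "src \<alpha>" "tgt \<alpha>" \<alpha> \<beta>]
  by (simp add: peq_def C.Hom_iff)

lemma peq_LM: "\<alpha> \<approx> \<beta> \<Longrightarrow> valid (LM g \<alpha>) \<Longrightarrow> LM g \<alpha> \<approx> LM g \<beta>"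
  using perm.cong_lm[of g C "Dom C g" "Cod C g" "over \<alpha>" "Cod C (over \<alpha>)" D p "src \<alpha>" "tgt \<alpha>" \<alpha> \<beta>]
  by (simp add: peq_def C.Hom_iff)

lemma peq_RM: "\<alpha> \<approx> \<beta> \<Longrightarrow> valid (RM f g \<alpha>) \<Longrightarrow> RM f g \<alpha> \<approx> RM f g \<beta>"
  using perm.cong_rm[of f C "Dom C f" "Dom C g" g "Cod C g" D p "src \<alpha>" "tgt \<alpha>" \<alpha> \<beta>]
  by (simp add: peq_def C.Hom_iff)

lemma peq_RP_LM: "valid (LM f (RP h \<alpha>)) \<Longrightarrow> RP h (LM f \<alpha>) \<approx> LM f (RP h \<alpha>)"
  unfolding peq_def by (rule perm.rp_lm) (auto simp: deriv_iff)

lemma peq_RP_LP: "valid (RP h (LP f g \<alpha>)) \<Longrightarrow> RP h (LP f g \<alpha>) \<approx> LP f (g \<cdot>\<^bsub>C\<^esub> h) (RP h \<alpha>)"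
  unfolding peq_def by (rule perm.rp_lp) (auto simp: deriv_iff)

lemma peq_RM_LM: "valid (LM f (RM g h \<alpha>)) \<Longrightarrow> RM (f \<cdot>\<^bsub>C\<^esub> g) h (LM f \<alpha>) \<approx> LM f (RM g h \<alpha>)"
  unfolding peq_def by (rule perm.rm_lm) (auto simp: deriv_iff)

lemma peq_RM_LP:
  "valid (LP f g (RM (f \<cdot>\<^bsub>C\<^esub> g) h \<alpha>)) \<Longrightarrow>
    RM g h (LP f (g \<cdot>\<^bsub>C\<^esub> h) \<alpha>) \<approx> LP f g (RM (f \<cdot>\<^bsub>C\<^esub> g) h \<alpha>)"
  unfolding peq_def by (rule perm.rm_lp) (auto simp: deriv_iff)

lemma peq_induct [consumes 1, case_names refl sym trans LP RP LM RM RP_LM RP_LP RM_LM RM_LP]: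
  assumes "\<alpha> \<approx> \<beta>"
    and "\<And>\<alpha>. valid \<alpha> \<Longrightarrow> P \<alpha> \<alpha>"
    and "\<And>\<alpha> \<beta>. \<alpha> \<approx> \<beta> \<Longrightarrow> P \<alpha> \<beta> \<Longrightarrow> P \<beta> \<alpha>"
    and "\<And>\<alpha> \<beta> \<gamma>. \<alpha> \<approx> \<beta> \<Longrightarrow> P \<alpha> \<beta> \<Longrightarrow> \<beta> \<approx> \<gamma> \<Longrightarrow> P \<beta> \<gamma> \<Longrightarrow> P \<alpha> \<gamma>"
    and "\<And>f g \<alpha> \<beta>. \<alpha> \<approx> \<beta> \<Longrightarrow> P \<alpha> \<beta> \<Longrightarrow> valid (LP f g \<alpha>) \<Longrightarrow> P (LP f g \<alpha>) (LP f g \<beta>)"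
    and "\<And>f \<alpha> \<beta>. \<alpha> \<approx> \<beta> \<Longrightarrow> P \<alpha> \<beta> \<Longrightarrow> valid (RP f \<alpha>) \<Longrightarrow> P (RP f \<alpha>) (RP f \<beta>)"
    and "\<And>g \<alpha> \<beta>. \<alpha> \<approx> \<beta> \<Longrightarrow> P \<alpha> \<beta> \<Longrightarrow> valid (LM g \<alpha>) \<Longrightarrow> P (LM g \<alpha>) (LM g \<beta>)"
    and "\<And>f g \<alpha> \<beta>. \<alpha> \<approx> \<beta> \<Longrightarrow> P \<alpha> \<beta> \<Longrightarrow> valid (RM f g \<alpha>) \<Longrightarrow> P (RM f g \<alpha>) (RM f g \<beta>)"
    and "\<And>h f \<alpha>. valid (LM f (RP h \<alpha>)) \<Longrightarrow> P (RP h (LM f \<alpha>)) (LM f (RP h \<alpha>))"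
    and "\<And>h f g \<alpha>. valid (RP h (LP f g \<alpha>)) \<Longrightarrow>
          P (RP h (LP f g \<alpha>)) (LP f (g \<cdot>\<^bsub>C\<^esub> h) (RP h \<alpha>))"
    and "\<And>f g h \<alpha>. valid (LM f (RM g h \<alpha>)) \<Longrightarrow>
          P (RM (f \<cdot>\<^bsub>C\<^esub> g) h (LM f \<alpha>)) (LM f (RM g h \<alpha>))"
    and "\<And>f g h \<alpha>. valid (LP f g (RM (f \<cdot>\<^bsub>C\<^esub> g) h \<alpha>)) \<Longrightarrow>
          P (RM g h (LP f (g \<cdot>\<^bsub>C\<^esub> h) \<alpha>)) (LP f g (RM (f \<cdot>\<^bsub>C\<^esub> g) h \<alpha>))"
  shows "P \<alpha> \<beta>"
proof -
  have "P \<alpha> \<beta>" if "perm D C p S h T \<alpha> \<beta>" for S h T \<alpha> \<beta>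
    using that
  proof (induction rule: perm.induct)
    case (refl S h T \<alpha>) then show ?case by (simp add: deriv_iff assms)
  next
    case (sym S h T \<alpha> \<beta>) then show ?case using assms(3) perm_iff by blast
  next
    case (trans S h T \<alpha> \<beta> \<gamma>) then show ?case using assms(4) perm_iff by blast
  next
    case (cong_lp f A B g B' S T \<alpha> \<beta>)
    then show ?case by (intro assms(5)) (auto simp: perm_iff C.Hom_iff dest: peqD)
  next
    case (cong_rp f' A B f B' S' S \<alpha> \<beta>)
    then show ?case by (intro assms(6)) (auto simp: perm_iff C.Hom_iff dest: peqD)
  next
    case (cong_lm g A B g' B' T T' \<alpha> \<beta>)
    then show ?case by (intro assms(7)) (auto simp: perm_iff C.Hom_iff dest: peqD)
  next
    case (cong_rm f A B g B' S T \<alpha> \<beta>)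
    then show ?case by (intro assms(8)) (auto simp: perm_iff C.Hom_iff dest: peqD)
  qed (use assms(9-12) deriv_iff in blast)+
  then show ?thesis using assms(1) by (auto simp: peq_def)
qed


section \<open>Cut elimination\<close>

text \<open>The clauses are tried in order: left rules of the first derivation, then right rules of the
  second, then the principal cuts and the cut of two axioms. The remaining pairs of derivations
  are not composable, and the value there is irrelevant.\<close>

fun cut_elim :: "('d, 'a) derivation \<Rightarrow> ('d, 'a) derivation \<Rightarrow> ('d, 'a) derivation" where
  "cut_elim (LP f g \<alpha>) \<beta> = LP f (g \<cdot>\<^bsub>C\<^esub> over \<beta>) (cut_elim \<alpha> \<beta>)"
| "cut_elim (LM f \<alpha>) \<beta> = LM f (cut_elim \<alpha> \<beta>)"
| "cut_elim \<alpha> (RP f \<beta>) = RP f (cut_elim \<alpha> \<beta>)"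
| "cut_elim \<alpha> (RM h f \<beta>) = RM (over \<alpha> \<cdot>\<^bsub>C\<^esub> h) f (cut_elim \<alpha> \<beta>)"
| "cut_elim (RP f \<alpha>) (LP f' h \<beta>) = cut_elim \<alpha> \<beta>"
| "cut_elim (RM g f \<alpha>) (LM f' \<beta>) = cut_elim \<alpha> \<beta>"
| "cut_elim (Ax \<delta>) (Ax \<epsilon>) = Ax (\<delta> \<cdot>\<^bsub>D\<^esub> \<epsilon>)"

text \<open>The condition on base arrows follows from the others (\<open>composableI\<close>); including it lets the
  simplifier see it.\<close>

definition composable :: "('d, 'a) derivation \<Rightarrow> ('d, 'a) derivation \<Rightarrow> bool" where
  "composable \<alpha> \<beta> \<longleftrightarrow> valid \<alpha> \<and> valid \<beta> \<and> tgt \<alpha> = src \<beta> \<and> Cod C (over \<alpha>) = Dom C (over \<beta>)"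

lemma composableI: "valid \<alpha> \<Longrightarrow> valid \<beta> \<Longrightarrow> tgt \<alpha> = src \<beta> \<Longrightarrow> composable \<alpha> \<beta>"
  unfolding composable_def by (metis base_src base_tgt)

lemma composableD:
  assumes "composable \<alpha> \<beta>"
  shows "valid \<alpha>" "valid \<beta>" "tgt \<alpha> = src \<beta>" "Cod C (over \<alpha>) = Dom C (over \<beta>)"
  using assms by (auto simp: composable_def)

lemma composable_simps [simp]:
  "composable (LP f g \<alpha>) \<beta> \<longleftrightarrow> valid (LP f g \<alpha>) \<and> composable \<alpha> \<beta>"
  "composable (LM g \<alpha>) \<beta> \<longleftrightarrow> valid (LM g \<alpha>) \<and> composable \<alpha> \<beta>"
  "composable \<alpha> (RP f \<beta>) \<longleftrightarrow> valid (RP f \<beta>) \<and> composable \<alpha> \<beta>"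
  "composable \<alpha> (RM f g \<beta>) \<longleftrightarrow> valid (RM f g \<beta>) \<and> composable \<alpha> \<beta>"
  "composable (RP f \<alpha>) (LP f' g \<beta>) \<longleftrightarrow>
     f' = f \<and> valid (RP f \<alpha>) \<and> valid (LP f g \<beta>) \<and> composable \<alpha> \<beta>"
  "composable (RM g f \<alpha>) (LM f' \<beta>) \<longleftrightarrow>
     f' = f \<and> valid (RM g f \<alpha>) \<and> valid (LM f \<beta>) \<and> composable \<alpha> \<beta>"
  "composable (Ax \<delta>) (Ax \<epsilon>) \<longleftrightarrow> \<delta> \<in> Arr D \<and> \<epsilon> \<in> Arr D \<and> Cod D \<delta> = Dom D \<epsilon>"
  "\<not> composable (Ax \<delta>) (LP f g \<beta>)" "\<not> composable (Ax \<delta>) (LM f \<beta>)"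
  "\<not> composable (RP f \<alpha>) (Ax \<epsilon>)" "\<not> composable (RM g f \<alpha>) (Ax \<epsilon>)"
  "\<not> composable (RP f \<alpha>) (LM f' \<beta>)" "\<not> composable (RM g f \<alpha>) (LP f' h \<beta>)"
  by (auto simp: composable_def)

lemma cut_elim_typing:
  "composable \<alpha> \<beta> \<Longrightarrow> valid (cut_elim \<alpha> \<beta>) \<and> src (cut_elim \<alpha> \<beta>) = src \<alpha> \<and>
    tgt (cut_elim \<alpha> \<beta>) = tgt \<beta> \<and> over (cut_elim \<alpha> \<beta>) = over \<alpha> \<cdot>\<^bsub>C\<^esub> over \<beta>"
  by (induction \<alpha> \<beta> rule: cut_elim.induct) (auto simp: onArr_seq composable_def)

lemma cut_elim_simps [simp]:
  assumes "composable \<alpha> \<beta>"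
  shows "valid (cut_elim \<alpha> \<beta>)" "src (cut_elim \<alpha> \<beta>) = src \<alpha>" "tgt (cut_elim \<alpha> \<beta>) = tgt \<beta>"
    "over (cut_elim \<alpha> \<beta>) = over \<alpha> \<cdot>\<^bsub>C\<^esub> over \<beta>"
  using cut_elim_typing[OF assms] by auto

text \<open>Right rules of the second derivation permute outwards even past the left rules of the first,
  which the strategy treats first.\<close>

lemma cut_elim_RP: "composable \<alpha> (RP f \<beta>) \<Longrightarrow> cut_elim \<alpha> (RP f \<beta>) \<approx> RP f (cut_elim \<alpha> \<beta>)"
proof (induction \<alpha>)
  case (LP k l \<alpha>)
  then have c: "composable \<alpha> \<beta>" by simp
  note c = c composableD[OF c]
  have "cut_elim (LP k l \<alpha>) (RP f \<beta>) \<approx> LP k (l \<cdot>\<^bsub>C\<^esub> over (RP f \<beta>)) (RP f (cut_elim \<alpha> \<beta>))"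
    using LP c by (auto intro!: peq_LP simp: composable_def)
  also have "\<dots> \<approx> RP f (cut_elim (LP k l \<alpha>) \<beta>)"
    using peq_sym[OF peq_RP_LP[of f k "l \<cdot>\<^bsub>C\<^esub> over \<beta>" "cut_elim \<alpha> \<beta>"]] LP c by (auto simp: composable_def)
  finally show ?case .
next
  case (LM k \<alpha>)
  then have c: "composable \<alpha> \<beta>" by simp
  note c = c composableD[OF c]
  have "cut_elim (LM k \<alpha>) (RP f \<beta>) \<approx> LM k (RP f (cut_elim \<alpha> \<beta>))"
    using LM c by (auto intro!: peq_LM simp: composable_def)
  also have "\<dots> \<approx> RP f (cut_elim (LM k \<alpha>) \<beta>)"
    using peq_sym[OF peq_RP_LM[of k f "cut_elim \<alpha> \<beta>"]] LM c by (auto simp: composable_def)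
  finally show ?case .
qed (auto intro!: peq_refl simp: composable_def)

lemma cut_elim_RM:
  "composable \<alpha> (RM h f \<beta>) \<Longrightarrow>
    cut_elim \<alpha> (RM h f \<beta>) \<approx> RM (over \<alpha> \<cdot>\<^bsub>C\<^esub> h) f (cut_elim \<alpha> \<beta>)"
proof (induction \<alpha>)
  case (LP k l \<alpha>)
  then have c: "composable \<alpha> \<beta>" by simp
  note c = c composableD[OF c]
  have "cut_elim (LP k l \<alpha>) (RM h f \<beta>) \<approx>
      LP k (l \<cdot>\<^bsub>C\<^esub> h) (RM (over \<alpha> \<cdot>\<^bsub>C\<^esub> h) f (cut_elim \<alpha> \<beta>))"
    using LP c by (auto intro!: peq_LP simp: composable_def)
  also have "\<dots> \<approx> RM (l \<cdot>\<^bsub>C\<^esub> h) f (cut_elim (LP k l \<alpha>) \<beta>)"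
    using peq_sym[OF peq_RM_LP[of k "l \<cdot>\<^bsub>C\<^esub> h" f "cut_elim \<alpha> \<beta>"]] LP c by (auto simp: composable_def)
  finally show ?case by simp
next
  case (LM k \<alpha>)
  then have c: "composable \<alpha> \<beta>" by simp
  note c = c composableD[OF c]
  have "cut_elim (LM k \<alpha>) (RM h f \<beta>) \<approx> LM k (RM (over \<alpha> \<cdot>\<^bsub>C\<^esub> h) f (cut_elim \<alpha> \<beta>))"
    using LM c by (auto intro!: peq_LM simp: composable_def)
  also have "\<dots> \<approx> RM (over (LM k \<alpha>) \<cdot>\<^bsub>C\<^esub> h) f (cut_elim (LM k \<alpha>) \<beta>)"
    using peq_sym[OF peq_RM_LM[of k "over \<alpha> \<cdot>\<^bsub>C\<^esub> h" f "cut_elim \<alpha> \<beta>"]] LM c by (auto simp: composable_def)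
  finally show ?case .
qed (auto intro!: peq_refl simp: composable_def)

lemma cut_elim_RM':
  assumes "composable \<alpha> (RM h f \<beta>)" "k = over \<alpha> \<cdot>\<^bsub>C\<^esub> h"
  shows "cut_elim \<alpha> (RM h f \<beta>) \<approx> RM k f (cut_elim \<alpha> \<beta>)"
  using cut_elim_RM[OF assms(1)] assms(2) by simp

lemma composable_peq: "\<alpha> \<approx> \<alpha>' \<Longrightarrow> \<beta> \<approx> \<beta>' \<Longrightarrow> composable \<alpha> \<beta> \<longleftrightarrow> composable \<alpha>' \<beta>'"
  by (simp add: composable_def peqD)

text \<open>To compare cuts of two equivalent derivations with \<open>\<beta>\<close> it is enough to consider \<open>\<beta>\<close> not ending
  in a right rule; dually for the other argument in \<open>cut_elim_right_transfer\<close>.\<close>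

lemma cut_elim_left_transfer:
  assumes "\<alpha> \<approx> \<alpha>'" "composable \<alpha> \<beta>"
    and "\<And>\<beta>. composable \<alpha> \<beta> \<Longrightarrow> (\<forall>f \<gamma>. \<beta> \<noteq> RP f \<gamma>) \<Longrightarrow> (\<forall>h f \<gamma>. \<beta> \<noteq> RM h f \<gamma>) \<Longrightarrow>
        cut_elim \<alpha> \<beta> \<approx> cut_elim \<alpha>' \<beta>"
  shows "cut_elim \<alpha> \<beta> \<approx> cut_elim \<alpha>' \<beta>"
  using assms(2)
proof (induction \<beta>)
  case (RP f \<beta>)
  have *: "cut_elim \<alpha> (RP f \<beta>) \<approx> RP f (cut_elim \<alpha> \<beta>)" using RP by (intro cut_elim_RP)
  also have "\<dots> \<approx> RP f (cut_elim \<alpha>' \<beta>)"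
    using RP peqD(2)[OF *] by (intro peq_RP) auto
  also have "\<dots> \<approx> cut_elim \<alpha>' (RP f \<beta>)"
    using RP(2) composable_peq[OF assms(1) peq_refl[of "RP f \<beta>"]]
    by (intro peq_sym[OF cut_elim_RP]) auto
  finally show ?case .
next
  case (RM h f \<beta>)
  have *: "cut_elim \<alpha> (RM h f \<beta>) \<approx> RM (over \<alpha> \<cdot>\<^bsub>C\<^esub> h) f (cut_elim \<alpha> \<beta>)"
    using RM by (intro cut_elim_RM)
  also have "\<dots> \<approx> RM (over \<alpha> \<cdot>\<^bsub>C\<^esub> h) f (cut_elim \<alpha>' \<beta>)"
    using RM peqD(2)[OF *] by (intro peq_RM) auto
  also have "\<dots> \<approx> cut_elim \<alpha>' (RM h f \<beta>)"
    unfolding peqD(4)[OF assms(1)]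
    using RM(2) composable_peq[OF assms(1) peq_refl[of "RM h f \<beta>"]]
    by (intro peq_sym[OF cut_elim_RM]) auto
  finally show ?case .
qed (use assms(3) in auto)

lemma cut_elim_peq_left:
  assumes "\<alpha> \<approx> \<alpha>'" "composable \<alpha> \<beta>"
  shows "cut_elim \<alpha> \<beta> \<approx> cut_elim \<alpha>' \<beta>"
  using assms
proof (induction arbitrary: \<beta> rule: peq_induct)
  case (refl \<alpha>)
  then show ?case by (simp add: peq_refl)
next
  case (sym \<alpha> \<alpha>')
  then show ?case using composable_peq peq_refl peq_sym composableD(1,2) by meson
next
  case (trans \<alpha> \<alpha>' \<alpha>'')
  then show ?case using composable_peq peq_refl peq_trans composableD(1,2) by meson
next
  case (LP f g \<alpha> \<alpha>')
  then show ?case by (auto intro!: peq_LP simp: composable_def)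
next
  case (LM f \<alpha> \<alpha>')
  then show ?case by (auto intro!: peq_LM simp: composable_def)
next
  case (RP f \<alpha> \<alpha>')
  show ?case
  proof (rule cut_elim_left_transfer[OF peq_RP RP(4)])
    fix \<beta> assume "composable (RP f \<alpha>) \<beta>" "\<forall>f \<gamma>. \<beta> \<noteq> RP f \<gamma>" "\<forall>h f \<gamma>. \<beta> \<noteq> RM h f \<gamma>"
    then show "cut_elim (RP f \<alpha>) \<beta> \<approx> cut_elim (RP f \<alpha>') \<beta>"
      using RP by (cases \<beta>) (auto simp: composable_def)
  qed (use RP in auto)
next
  case (RM h f \<alpha> \<alpha>')
  show ?case
  proof (rule cut_elim_left_transfer[OF peq_RM RM(4)])
    fix \<beta> assume "composable (RM h f \<alpha>) \<beta>" "\<forall>f \<gamma>. \<beta> \<noteq> RP f \<gamma>" "\<forall>h f \<gamma>. \<beta> \<noteq> RM h f \<gamma>"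
    then show "cut_elim (RM h f \<alpha>) \<beta> \<approx> cut_elim (RM h f \<alpha>') \<beta>"
      using RM by (cases \<beta>) (auto simp: composable_def)
  qed (use RM in auto)
next
  case (RP_LM h f \<alpha>)
  show ?case
  proof (rule cut_elim_left_transfer[OF peq_RP_LM[OF RP_LM(1)] RP_LM(2)])
    fix \<beta> assume "composable (RP h (LM f \<alpha>)) \<beta>" "\<forall>f \<gamma>. \<beta> \<noteq> RP f \<gamma>" "\<forall>h f \<gamma>. \<beta> \<noteq> RM h f \<gamma>"
    then show "cut_elim (RP h (LM f \<alpha>)) \<beta> \<approx> cut_elim (LM f (RP h \<alpha>)) \<beta>"
      by (cases \<beta>) (auto intro!: peq_refl simp: composable_def)
  qed
next
  case (RP_LP h f g \<alpha>)
  show ?case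
  proof (rule cut_elim_left_transfer[OF peq_RP_LP[OF RP_LP(1)] RP_LP(2)])
    fix \<beta> assume "composable (RP h (LP f g \<alpha>)) \<beta>" "\<forall>f \<gamma>. \<beta> \<noteq> RP f \<gamma>" "\<forall>h f \<gamma>. \<beta> \<noteq> RM h f \<gamma>"
    then show "cut_elim (RP h (LP f g \<alpha>)) \<beta> \<approx> cut_elim (LP f (g \<cdot>\<^bsub>C\<^esub> h) (RP h \<alpha>)) \<beta>"
      by (cases \<beta>) (auto intro!: peq_refl simp: composable_def)
  qed
next
  case (RM_LM f g h \<alpha>)
  show ?case
  proof (rule cut_elim_left_transfer[OF peq_RM_LM[OF RM_LM(1)] RM_LM(2)])
    fix \<beta> assume "composable (RM (f \<cdot>\<^bsub>C\<^esub> g) h (LM f \<alpha>)) \<beta>"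
      "\<forall>f \<gamma>. \<beta> \<noteq> RP f \<gamma>" "\<forall>h f \<gamma>. \<beta> \<noteq> RM h f \<gamma>"
    then show "cut_elim (RM (f \<cdot>\<^bsub>C\<^esub> g) h (LM f \<alpha>)) \<beta> \<approx> cut_elim (LM f (RM g h \<alpha>)) \<beta>"
      using RM_LM(1) by (cases \<beta>) (auto intro!: peq_refl simp: composable_def)
  qed
next
  case (RM_LP f g h \<alpha>)
  show ?case
  proof (rule cut_elim_left_transfer[OF peq_RM_LP[OF RM_LP(1)] RM_LP(2)])
    fix \<beta> assume "composable (RM g h (LP f (g \<cdot>\<^bsub>C\<^esub> h) \<alpha>)) \<beta>"
      "\<forall>f \<gamma>. \<beta> \<noteq> RP f \<gamma>" "\<forall>h f \<gamma>. \<beta> \<noteq> RM h f \<gamma>"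
    then show "cut_elim (RM g h (LP f (g \<cdot>\<^bsub>C\<^esub> h) \<alpha>)) \<beta> \<approx>
        cut_elim (LP f g (RM (f \<cdot>\<^bsub>C\<^esub> g) h \<alpha>)) \<beta>"
      by (cases \<beta>) (auto intro!: peq_refl simp: composable_def)
  qed
qed

lemma cut_elim_right_transfer:
  assumes "\<beta> \<approx> \<beta>'" "composable \<alpha> \<beta>"
    and "\<And>\<alpha>. composable \<alpha> \<beta> \<Longrightarrow> (\<forall>f g \<gamma>. \<alpha> \<noteq> LP f g \<gamma>) \<Longrightarrow> (\<forall>f \<gamma>. \<alpha> \<noteq> LM f \<gamma>) \<Longrightarrow>
        cut_elim \<alpha> \<beta> \<approx> cut_elim \<alpha> \<beta>'"
  shows "cut_elim \<alpha> \<beta> \<approx> cut_elim \<alpha> \<beta>'"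
  using assms(2)
proof (induction \<alpha>)
  case (LP f g \<alpha>)
  then show ?case using peqD(2,4)[OF assms(1)] over_Arr[of \<beta>'] by (auto intro!: peq_LP simp: composable_def)
next
  case (LM f \<alpha>)
  then show ?case by (auto intro!: peq_LM simp: composable_def)
qed (use assms(3) in auto)

lemma cut_elim_peq_right:
  assumes "\<beta> \<approx> \<beta>'" "composable \<alpha> \<beta>"
  shows "cut_elim \<alpha> \<beta> \<approx> cut_elim \<alpha> \<beta>'"
  using assms
proof (induction arbitrary: \<alpha> rule: peq_induct)
  case (refl \<beta>)
  then show ?case by (simp add: peq_refl)
next
  case (sym \<beta> \<beta>')
  then show ?case using composable_peq peq_refl peq_sym composableD(1,2) by meson
next
  case (trans \<beta> \<beta>' \<beta>'')
  then show ?case using composable_peq peq_refl peq_trans composableD(1,2) by meson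
next
  case (RP f \<beta> \<beta>')
  show ?case
  proof (rule cut_elim_right_transfer[OF peq_RP RP(4)])
    fix \<alpha> assume "composable \<alpha> (RP f \<beta>)" "\<forall>f g \<gamma>. \<alpha> \<noteq> LP f g \<gamma>" "\<forall>f \<gamma>. \<alpha> \<noteq> LM f \<gamma>"
    then show "cut_elim \<alpha> (RP f \<beta>) \<approx> cut_elim \<alpha> (RP f \<beta>')"
      using RP by (cases \<alpha>) (auto intro!: peq_RP simp: composable_def)
  qed (use RP in auto)
next
  case (RM h f \<beta> \<beta>')
  show ?case
  proof (rule cut_elim_right_transfer[OF peq_RM RM(4)])
    fix \<alpha> assume "composable \<alpha> (RM h f \<beta>)" "\<forall>f g \<gamma>. \<alpha> \<noteq> LP f g \<gamma>" "\<forall>f \<gamma>. \<alpha> \<noteq> LM f \<gamma>"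
    then show "cut_elim \<alpha> (RM h f \<beta>) \<approx> cut_elim \<alpha> (RM h f \<beta>')"
      using RM by (cases \<alpha>) (auto intro!: peq_RM simp: composable_def)
  qed (use RM in auto)
next
  case (LP f g \<beta> \<beta>')
  show ?case
  proof (rule cut_elim_right_transfer[OF peq_LP LP(4)])
    fix \<alpha> assume "composable \<alpha> (LP f g \<beta>)" "\<forall>f g \<gamma>. \<alpha> \<noteq> LP f g \<gamma>" "\<forall>f \<gamma>. \<alpha> \<noteq> LM f \<gamma>"
    then show "cut_elim \<alpha> (LP f g \<beta>) \<approx> cut_elim \<alpha> (LP f g \<beta>')"
      using LP by (cases \<alpha>) (auto simp: composable_def)
  qed (use LP in auto)
next
  case (LM f \<beta> \<beta>')
  show ?case
  proof (rule cut_elim_right_transfer[OF peq_LM LM(4)])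
    fix \<alpha> assume "composable \<alpha> (LM f \<beta>)" "\<forall>f g \<gamma>. \<alpha> \<noteq> LP f g \<gamma>" "\<forall>f \<gamma>. \<alpha> \<noteq> LM f \<gamma>"
    then show "cut_elim \<alpha> (LM f \<beta>) \<approx> cut_elim \<alpha> (LM f \<beta>')"
      using LM by (cases \<alpha>) (auto simp: composable_def)
  qed (use LM in auto)
next
  case (RP_LM h f \<beta>)
  show ?case
  proof (rule cut_elim_right_transfer[OF peq_RP_LM[OF RP_LM(1)] RP_LM(2)])
    fix \<alpha> assume "composable \<alpha> (RP h (LM f \<beta>))" "\<forall>f g \<gamma>. \<alpha> \<noteq> LP f g \<gamma>" "\<forall>f \<gamma>. \<alpha> \<noteq> LM f \<gamma>"
    then show "cut_elim \<alpha> (RP h (LM f \<beta>)) \<approx> cut_elim \<alpha> (LM f (RP h \<beta>))"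
      by (cases \<alpha>) (auto intro!: peq_sym[OF cut_elim_RP] simp: composable_def)
  qed
next
  case (RP_LP h f g \<beta>)
  show ?case
  proof (rule cut_elim_right_transfer[OF peq_RP_LP[OF RP_LP(1)] RP_LP(2)])
    fix \<alpha> assume "composable \<alpha> (RP h (LP f g \<beta>))" "\<forall>f g \<gamma>. \<alpha> \<noteq> LP f g \<gamma>" "\<forall>f \<gamma>. \<alpha> \<noteq> LM f \<gamma>"
    then show "cut_elim \<alpha> (RP h (LP f g \<beta>)) \<approx> cut_elim \<alpha> (LP f (g \<cdot>\<^bsub>C\<^esub> h) (RP h \<beta>))"
      by (cases \<alpha>) (auto intro!: peq_sym[OF cut_elim_RP] simp: composable_def)
  qed
next
  case (RM_LM f g h \<beta>)
  show ?case
  proof (rule cut_elim_right_transfer[OF peq_RM_LM[OF RM_LM(1)] RM_LM(2)])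
    fix \<alpha> assume "composable \<alpha> (RM (f \<cdot>\<^bsub>C\<^esub> g) h (LM f \<beta>))"
      "\<forall>f g \<gamma>. \<alpha> \<noteq> LP f g \<gamma>" "\<forall>f \<gamma>. \<alpha> \<noteq> LM f \<gamma>"
    then show "cut_elim \<alpha> (RM (f \<cdot>\<^bsub>C\<^esub> g) h (LM f \<beta>)) \<approx> cut_elim \<alpha> (LM f (RM g h \<beta>))"
      using RM_LM(1) by (cases \<alpha>) (auto intro!: peq_sym[OF cut_elim_RM'] simp: composable_def)
  qed
next
  case (RM_LP f g h \<beta>)
  show ?case
  proof (rule cut_elim_right_transfer[OF peq_RM_LP[OF RM_LP(1)] RM_LP(2)])
    fix \<alpha> assume "composable \<alpha> (RM g h (LP f (g \<cdot>\<^bsub>C\<^esub> h) \<beta>))"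
      "\<forall>f g \<gamma>. \<alpha> \<noteq> LP f g \<gamma>" "\<forall>f \<gamma>. \<alpha> \<noteq> LM f \<gamma>"
    then show "cut_elim \<alpha> (RM g h (LP f (g \<cdot>\<^bsub>C\<^esub> h) \<beta>)) \<approx>
        cut_elim \<alpha> (LP f g (RM (f \<cdot>\<^bsub>C\<^esub> g) h \<beta>))"
      using RM_LP(1) by (cases \<alpha>) (auto intro!: peq_sym[OF cut_elim_RM'] simp: composable_def)
  qed
qed

lemma cut_elim_peq:
  assumes "\<alpha> \<approx> \<alpha>'" "\<beta> \<approx> \<beta>'" "composable \<alpha> \<beta>"
  shows "cut_elim \<alpha> \<beta> \<approx> cut_elim \<alpha>' \<beta>'"
  using cut_elim_peq_left[OF assms(1,3)] cut_elim_peq_right[OF assms(2), of \<alpha>'] assms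
    composable_peq[OF assms(1) peq_refl[of \<beta>]] composableD(1,2) peq_trans by blast

text \<open>Cut is unique up to permutation: every value allowed by the clauses is equivalent to the one
  that the strategy computes. By \<open>cut_relation_cut_elim\<close> the latter is among the allowed values.\<close>

lemma cut_relation_peq: "cut D C p \<alpha> \<beta> \<gamma> \<Longrightarrow> composable \<alpha> \<beta> \<Longrightarrow> \<gamma> \<approx> cut_elim \<alpha> \<beta>"
proof (induction rule: cut.induct)
  case (ax_ax \<delta> \<epsilon>)
  then show ?case by (auto intro: peq_refl)
next
  case (rp_lp \<alpha> \<beta> \<gamma> f h)
  then show ?case by simp
next
  case (rm_lm \<alpha> \<beta> \<gamma> g f)
  then show ?case by simp
next
  case (lm_left \<alpha> \<beta> \<gamma> f)
  then show ?case
    using peqD[of \<gamma> "cut_elim \<alpha> \<beta>"] by (auto intro!: peq_LM simp: composable_def)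
next
  case (lp_left T h U \<beta> \<alpha> \<gamma> f g)
  then show ?case
    using peqD[of \<gamma> "cut_elim \<alpha> \<beta>"] by (auto intro!: peq_LP simp: composable_def deriv_iff)
next
  case (rp_right \<alpha> \<beta> \<gamma> f)
  then have "RP f \<gamma> \<approx> RP f (cut_elim \<alpha> \<beta>)"
    using peqD[of \<gamma> "cut_elim \<alpha> \<beta>"] by (auto intro!: peq_RP simp: composable_def)
  also have "\<dots> \<approx> cut_elim \<alpha> (RP f \<beta>)" using rp_right by (intro peq_sym[OF cut_elim_RP])
  finally show ?case .
next
  case (rm_right S g T \<alpha> \<beta> \<gamma> h f)
  then have "RM (g \<cdot>\<^bsub>C\<^esub> h) f \<gamma> \<approx> RM (g \<cdot>\<^bsub>C\<^esub> h) f (cut_elim \<alpha> \<beta>)"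
    using peqD[of \<gamma> "cut_elim \<alpha> \<beta>"] by (auto intro!: peq_RM simp: composable_def deriv_iff)
  also have "\<dots> \<approx> cut_elim \<alpha> (RM h f \<beta>)"
    using rm_right by (intro peq_sym[OF cut_elim_RM']) (auto simp: deriv_iff)
  finally show ?case .
qed

lemma cut_relation_cut_elim: "composable \<alpha> \<beta> \<Longrightarrow> cut D C p \<alpha> \<beta> (cut_elim \<alpha> \<beta>)"
  by (induction \<alpha> \<beta> rule: cut_elim.induct)
    (auto intro!: cut.intros simp: deriv_iff composable_def)

lemma cut_elim_assoc:
  "composable \<alpha> \<beta> \<Longrightarrow> composable \<beta> \<gamma> \<Longrightarrow>
    cut_elim (cut_elim \<alpha> \<beta>) \<gamma> \<approx> cut_elim \<alpha> (cut_elim \<beta> \<gamma>)"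
proof (induction "size \<alpha> + size \<beta> + size \<gamma>" arbitrary: \<alpha> \<beta> \<gamma> rule: less_induct)
  case less
  have L: "composable (cut_elim \<alpha> \<beta>) \<gamma>" and R: "composable \<alpha> (cut_elim \<beta> \<gamma>)"
    using less.prems by (auto simp: composable_def)
  \<comment> \<open>If \<open>\<alpha>\<close> does not end in a left rule nor \<open>\<gamma>\<close> in a right rule, then \<open>\<beta>\<close>, unless it is an axiom,
    forms a principal cut with one of them.\<close>
  consider (LP) f g \<alpha>' where "\<alpha> = LP f g \<alpha>'" | (LM) f \<alpha>' where "\<alpha> = LM f \<alpha>'"
    | (RP) f \<gamma>' where "\<gamma> = RP f \<gamma>'" | (RM) g f \<gamma>' where "\<gamma> = RM g f \<gamma>'"
    | (Ax) \<delta> \<epsilon> \<zeta> where "\<alpha> = Ax \<delta>" "\<beta> = Ax \<epsilon>" "\<gamma> = Ax \<zeta>"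
    | (RP_LP1) f g \<alpha>' \<beta>' where "\<alpha> = RP f \<alpha>'" "\<beta> = LP f g \<beta>'"
    | (RM_LM1) f g \<alpha>' \<beta>' where "\<alpha> = RM g f \<alpha>'" "\<beta> = LM f \<beta>'"
    | (RP_LP2) f g \<beta>' \<gamma>' where "\<beta> = RP f \<beta>'" "\<gamma> = LP f g \<gamma>'"
    | (RM_LM2) f g \<beta>' \<gamma>' where "\<beta> = RM g f \<beta>'" "\<gamma> = LM f \<gamma>'"
    using less.prems by (cases \<alpha>; cases \<beta>; cases \<gamma>; simp)
  then show ?case
  proof cases
    case LP
    then have "cut_elim (cut_elim \<alpha>' \<beta>) \<gamma> \<approx> cut_elim \<alpha>' (cut_elim \<beta> \<gamma>)"
      using less.prems by (intro less.hyps) auto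
    then show ?thesis using LP less.prems by (auto intro!: peq_LP simp: composable_def)
  next
    case LM
    then have "cut_elim (cut_elim \<alpha>' \<beta>) \<gamma> \<approx> cut_elim \<alpha>' (cut_elim \<beta> \<gamma>)"
      using less.prems by (intro less.hyps) auto
    then show ?thesis using LM less.prems by (auto intro!: peq_LM simp: composable_def)
  next
    case RP
    have IH: "cut_elim (cut_elim \<alpha> \<beta>) \<gamma>' \<approx> cut_elim \<alpha> (cut_elim \<beta> \<gamma>')"
      using RP less.prems by (intro less.hyps) auto
    have "cut_elim (cut_elim \<alpha> \<beta>) \<gamma> \<approx> RP f (cut_elim (cut_elim \<alpha> \<beta>) \<gamma>')"
      using RP L by (auto intro: cut_elim_RP)
    also have "\<dots> \<approx> RP f (cut_elim \<alpha> (cut_elim \<beta> \<gamma>'))"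
      using RP less.prems IH by (auto intro!: peq_RP simp: composable_def)
    also have "\<dots> \<approx> cut_elim \<alpha> (RP f (cut_elim \<beta> \<gamma>'))"
      using RP less.prems by (intro peq_sym[OF cut_elim_RP]) (auto simp: composable_def)
    also have "\<dots> \<approx> cut_elim \<alpha> (cut_elim \<beta> \<gamma>)"
      using RP less.prems R
      by (auto intro!: cut_elim_peq_right peq_sym[OF cut_elim_RP] simp: composable_def)
    finally show ?thesis .
  next
    case RM
    have IH: "cut_elim (cut_elim \<alpha> \<beta>) \<gamma>' \<approx> cut_elim \<alpha> (cut_elim \<beta> \<gamma>')"
      using RM less.prems by (intro less.hyps) auto
    let ?k = "over \<alpha> \<cdot>\<^bsub>C\<^esub> over \<beta> \<cdot>\<^bsub>C\<^esub> g"
    have "cut_elim (cut_elim \<alpha> \<beta>) \<gamma> \<approx> RM ?k f (cut_elim (cut_elim \<alpha> \<beta>) \<gamma>')"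
      using RM L less.prems by (auto intro!: cut_elim_RM' simp: composable_def)
    also have "\<dots> \<approx> RM ?k f (cut_elim \<alpha> (cut_elim \<beta> \<gamma>'))"
      using RM less.prems IH by (auto intro!: peq_RM simp: composable_def)
    also have "\<dots> \<approx> cut_elim \<alpha> (RM (over \<beta> \<cdot>\<^bsub>C\<^esub> g) f (cut_elim \<beta> \<gamma>'))"
      using RM less.prems by (intro peq_sym[OF cut_elim_RM']) (auto simp: composable_def)
    also have "\<dots> \<approx> cut_elim \<alpha> (cut_elim \<beta> \<gamma>)"
      using RM less.prems R
      by (auto intro!: cut_elim_peq_right peq_sym[OF cut_elim_RM'] simp: composable_def)
    finally show ?thesis .
  next
    case Ax
    then show ?thesis using less.prems by (auto intro!: peq_refl)
  next
    case RP_LP1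
    then have "cut_elim (cut_elim \<alpha>' \<beta>') \<gamma> \<approx> cut_elim \<alpha>' (cut_elim \<beta>' \<gamma>)"
      using less.prems by (intro less.hyps) auto
    then show ?thesis using RP_LP1 by simp
  next
    case RM_LM1
    then have "cut_elim (cut_elim \<alpha>' \<beta>') \<gamma> \<approx> cut_elim \<alpha>' (cut_elim \<beta>' \<gamma>)"
      using less.prems by (intro less.hyps) auto
    then show ?thesis using RM_LM1 by simp
  next
    case RP_LP2
    have "cut_elim (cut_elim \<alpha> \<beta>) \<gamma> \<approx> cut_elim (RP f (cut_elim \<alpha> \<beta>')) \<gamma>"
      by (rule cut_elim_peq_left[OF _ L]) (use RP_LP2 less.prems(1) in \<open>auto intro!: cut_elim_RP\<close>)
    also have "\<dots> = cut_elim (cut_elim \<alpha> \<beta>') \<gamma>'"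
      using RP_LP2 by simp
    also have "\<dots> \<approx> cut_elim \<alpha> (cut_elim \<beta>' \<gamma>')"
      using RP_LP2 less.prems by (intro less.hyps) auto
    finally show ?thesis using RP_LP2 by simp
  next
    case RM_LM2
    have "cut_elim (cut_elim \<alpha> \<beta>) \<gamma> \<approx> cut_elim (RM (over \<alpha> \<cdot>\<^bsub>C\<^esub> g) f (cut_elim \<alpha> \<beta>')) \<gamma>"
      by (rule cut_elim_peq_left[OF _ L]) (use RM_LM2 less.prems(1) in \<open>auto intro!: cut_elim_RM\<close>)
    also have "\<dots> = cut_elim (cut_elim \<alpha> \<beta>') \<gamma>'"
      using RM_LM2 by simp
    also have "\<dots> \<approx> cut_elim \<alpha> (cut_elim \<beta>' \<gamma>')"
      using RM_LM2 less.prems by (intro less.hyps) auto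
    finally show ?thesis using RM_LM2 by simp
  qed
qed


section \<open>Identity derivations\<close>

text \<open>The well-formed formulas, which are the objects of \<open>Bif\<close>.\<close>

definition is_formula :: "('x, 'a) formula \<Rightarrow> bool" where
  "is_formula S \<longleftrightarrow> (\<exists>A. lies_over D C p S A)"

lemma is_formula_simps [simp]:
  "is_formula (Atom X) \<longleftrightarrow> X \<in> Obj D"
  "is_formula (Push f S) \<longleftrightarrow> is_formula S \<and> f \<in> Arr C \<and> Dom C f = base C p S"
  "is_formula (Pull f S) \<longleftrightarrow> is_formula S \<and> f \<in> Arr C \<and> Cod C f = base C p S"
  unfolding is_formula_def
  by (auto intro: lies_over.intros simp: C.Hom_iff base_eq elim: lies_over.cases)
    (metis C.Hom_iff base_eq lies_over.intros)+

lemma is_formula_src [simp]: "valid \<alpha> \<Longrightarrow> is_formula (src \<alpha>)"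
  and is_formula_tgt [simp]: "valid \<alpha> \<Longrightarrow> is_formula (tgt \<alpha>)"
  using lies_over_src_tgt is_formula_def by auto

lemma base_Obj [simp]: "is_formula S \<Longrightarrow> base C p S \<in> Obj C"
  by (cases S) (auto simp: onObj_Obj)

lemma id_deriv_typing:
  "is_formula S \<Longrightarrow> valid (id_deriv D C S) \<and> src (id_deriv D C S) = S \<and>
    tgt (id_deriv D C S) = S \<and> over (id_deriv D C S) = Idn C (base C p S)"
  by (induction S) (auto simp: onArr_Idn)

lemma id_deriv_simps [simp]:
  assumes "is_formula S"
  shows "valid (id_deriv D C S)" "src (id_deriv D C S) = S" "tgt (id_deriv D C S) = S"
    "over (id_deriv D C S) = Idn C (base C p S)"
  using id_deriv_typing[OF assms] by auto

lemma cut_id_left: "valid \<beta> \<Longrightarrow> S = src \<beta> \<Longrightarrow> cut_elim (id_deriv D C S) \<beta> \<approx> \<beta>"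
proof (induction \<beta> arbitrary: S)
  case (Ax \<delta>)
  then show ?case by (auto intro: peq_refl)
next
  case (LP f g \<beta>)
  then have IH: "cut_elim (id_deriv D C (src \<beta>)) \<beta> \<approx> \<beta>" by simp
  then show ?case using LP.prems peqD[OF IH] by (auto intro!: peq_LP)
next
  case (LM f \<beta>)
  then have IH: "cut_elim (id_deriv D C (src \<beta>)) \<beta> \<approx> \<beta>" by simp
  then show ?case using LM.prems peqD[OF IH] by (auto intro!: peq_LM)
next
  case (RP f \<beta>)
  then have IH: "cut_elim (id_deriv D C S) \<beta> \<approx> \<beta>" by simp
  have "cut_elim (id_deriv D C S) (RP f \<beta>) \<approx> RP f (cut_elim (id_deriv D C S) \<beta>)"
    using RP by (intro cut_elim_RP) (auto simp: composable_def)
  also have "\<dots> \<approx> RP f \<beta>"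
    using RP.prems IH peqD[OF IH] by (intro peq_RP) auto
  finally show ?case .
next
  case (RM h f \<beta>)
  then have IH: "cut_elim (id_deriv D C S) \<beta> \<approx> \<beta>" by simp
  have "cut_elim (id_deriv D C S) (RM h f \<beta>) \<approx> RM h f (cut_elim (id_deriv D C S) \<beta>)"
    using RM by (intro cut_elim_RM') (auto simp: composable_def)
  also have "\<dots> \<approx> RM h f \<beta>"
    using RM.prems IH peqD[OF IH] by (intro peq_RM) auto
  finally show ?case .
qed

lemma cut_id_right: "valid \<alpha> \<Longrightarrow> T = tgt \<alpha> \<Longrightarrow> cut_elim \<alpha> (id_deriv D C T) \<approx> \<alpha>"
proof (induction \<alpha> arbitrary: T)
  case (Ax \<delta>)
  then show ?case by (auto intro: peq_refl)
next
  case (LP f g \<alpha>)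
  then have IH: "cut_elim \<alpha> (id_deriv D C T) \<approx> \<alpha>" by simp
  then show ?case using LP.prems peqD[OF IH] by (auto intro!: peq_LP)
next
  case (LM f \<alpha>)
  then have IH: "cut_elim \<alpha> (id_deriv D C T) \<approx> \<alpha>" by simp
  then show ?case using LM.prems peqD[OF IH] by (auto intro!: peq_LM)
next
  case (RP f \<alpha>)
  then have IH: "cut_elim \<alpha> (id_deriv D C (tgt \<alpha>)) \<approx> \<alpha>" by simp
  have "cut_elim (RP f \<alpha>) (id_deriv D C T) = cut_elim \<alpha> (RP f (id_deriv D C (tgt \<alpha>)))"
    using RP.prems by simp
  also have "\<dots> \<approx> RP f (cut_elim \<alpha> (id_deriv D C (tgt \<alpha>)))"
    using RP.prems by (intro cut_elim_RP) (auto simp: composable_def)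
  also have "\<dots> \<approx> RP f \<alpha>"
    using RP.prems IH peqD[OF IH] by (intro peq_RP) auto
  finally show ?case .
next
  case (RM h f \<alpha>)
  then have IH: "cut_elim \<alpha> (id_deriv D C (tgt \<alpha>)) \<approx> \<alpha>" by simp
  let ?\<beta> = "LM f (id_deriv D C (tgt \<alpha>))"
  have "cut_elim (RM h f \<alpha>) (id_deriv D C T) = cut_elim (RM h f \<alpha>) (RM (Idn C (Dom C f)) f ?\<beta>)"
    using RM.prems by simp
  also have "\<dots> \<approx> RM h f (cut_elim (RM h f \<alpha>) ?\<beta>)"
    using RM.prems by (intro cut_elim_RM') (auto simp: composable_def)
  also have "\<dots> \<approx> RM h f \<alpha>"
    using RM.prems IH peqD[OF IH] by (intro peq_RM) auto
  finally show ?case .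
qed


section \<open>The category of formulas and permutation classes\<close>

text \<open>The arrow of \<open>Bif\<close> represented by a derivation.\<close>

definition cls :: "('d, 'a) derivation \<Rightarrow> ('x, 'd, 'a) bif_arrow" where
  "cls \<alpha> = class_of D C p (src \<alpha>) (over \<alpha>) (tgt \<alpha>) \<alpha>"

lemma cls_simps [simp]:
  "bsrc (cls \<alpha>) = src \<alpha>" "bover (cls \<alpha>) = over \<alpha>" "btgt (cls \<alpha>) = tgt \<alpha>"
  "bcls (cls \<alpha>) = {\<beta>. \<alpha> \<approx> \<beta>}"
  by (simp_all add: cls_def class_of_def peq_def)

lemma class_of_eq_cls: "src \<alpha> = S \<Longrightarrow> over \<alpha> = h \<Longrightarrow> tgt \<alpha> = T \<Longrightarrow> class_of D C p S h T \<alpha> = cls \<alpha>"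
  by (auto simp: cls_def)

lemma cls_eqI: "\<alpha> \<approx> \<beta> \<Longrightarrow> cls \<alpha> = cls \<beta>"
  by (rule bif_arrow.expand) (auto dest: peqD intro: peq_trans peq_sym)

lemma cls_eq_iff: "valid \<beta> \<Longrightarrow> cls \<alpha> = cls \<beta> \<longleftrightarrow> \<alpha> \<approx> \<beta>"
  using cls_eqI peq_refl cls_simps(4) by (metis mem_Collect_eq)

lemma Bif_simps [simp]:
  "Obj (Bif D C p) = {S. is_formula S}"
  "Arr (Bif D C p) = {cls \<alpha> | \<alpha>. valid \<alpha>}"
  "Dom (Bif D C p) = bsrc"
  "Cod (Bif D C p) = btgt"
  by (auto simp: Bif_def is_formula_def cls_def deriv_iff)

lemma cls_Arr: "valid \<alpha> \<Longrightarrow> cls \<alpha> \<in> Arr (Bif D C p)"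
  by auto

lemma Idn_Bif [simp]: "is_formula S \<Longrightarrow> Idn (Bif D C p) S = cls (id_deriv D C S)"
  by (simp add: Bif_def class_of_eq_cls)

lemma Hom_Bif: "Hom (Bif D C p) S T = {cls \<alpha> | \<alpha>. valid \<alpha> \<and> src \<alpha> = S \<and> tgt \<alpha> = T}"
  by (auto simp: Hom_def)

lemma Comp_Bif [simp]:
  assumes "composable \<alpha> \<beta>"
  shows "cls \<alpha> \<cdot>\<^bsub>Bif D C p\<^esub> cls \<beta> = cls (cut_elim \<alpha> \<beta>)"
proof -
  have "(\<exists>\<alpha>'. \<alpha> \<approx> \<alpha>' \<and> (\<exists>\<beta>'. \<beta> \<approx> \<beta>' \<and> (\<exists>\<gamma>'. cut D C p \<alpha>' \<beta>' \<gamma>' \<and>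
      perm D C p (src \<alpha>) (over \<alpha> \<cdot>\<^bsub>C\<^esub> over \<beta>) (tgt \<beta>) \<gamma>' \<gamma>))) \<longleftrightarrow> cut_elim \<alpha> \<beta> \<approx> \<gamma>"
    (is "?L \<longleftrightarrow> ?R") for \<gamma>
  proof
    assume ?L
    then obtain \<alpha>' \<beta>' \<gamma>' where *: "\<alpha> \<approx> \<alpha>'" "\<beta> \<approx> \<beta>'" "cut D C p \<alpha>' \<beta>' \<gamma>'" "\<gamma>' \<approx> \<gamma>"
      by (auto simp: perm_iff)
    have "cut_elim \<alpha> \<beta> \<approx> cut_elim \<alpha>' \<beta>'" using * assms by (intro cut_elim_peq)
    also have "\<dots> \<approx> \<gamma>'"
      using * assms composable_peq by (intro peq_sym[OF cut_relation_peq]) auto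
    finally show ?R using * peq_trans by blast
  next
    assume ?R
    then show ?L
      using assms composableD(1,2)[OF assms] cut_relation_cut_elim[OF assms]
      by (intro exI[of _ \<alpha>] exI[of _ \<beta>] exI[of _ "cut_elim \<alpha> \<beta>"] conjI)
        (auto simp: perm_iff intro: peq_refl)
  qed
  then show ?thesis
    using assms by (intro bif_arrow.expand) (auto simp: Bif_def bif_comp_def Let_def)
qed

lemma category_Bif: "category (Bif D C p)"
proof
  fix S T U V a b c
  assume a: "a \<in> Hom (Bif D C p) S T"
  then obtain \<alpha> where \<alpha>: "a = cls \<alpha>" "valid \<alpha>" "src \<alpha> = S" "tgt \<alpha> = T" by (auto simp: Hom_Bif)
  then show "Idn (Bif D C p) S \<cdot>\<^bsub>Bif D C p\<^esub> a = a" "a \<cdot>\<^bsub>Bif D C p\<^esub> Idn (Bif D C p) T = a"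
    by (auto simp: composableI intro!: cls_eqI cut_id_left cut_id_right)
  assume b: "b \<in> Hom (Bif D C p) T U"
  then obtain \<beta> where \<beta>: "b = cls \<beta>" "valid \<beta>" "src \<beta> = T" "tgt \<beta> = U" by (auto simp: Hom_Bif)
  have \<alpha>\<beta>: "composable \<alpha> \<beta>" using \<alpha> \<beta> by (simp add: composableI)
  then show "a \<cdot>\<^bsub>Bif D C p\<^esub> b \<in> Hom (Bif D C p) S U"
    using \<alpha> \<beta> by (auto simp: Hom_Bif)
  assume c: "c \<in> Hom (Bif D C p) U V"
  then obtain \<gamma> where \<gamma>: "c = cls \<gamma>" "valid \<gamma>" "src \<gamma> = U" "tgt \<gamma> = V" by (auto simp: Hom_Bif)
  have \<beta>\<gamma>: "composable \<beta> \<gamma>" using \<beta> \<gamma> by (simp add: composableI)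
  have "composable (cut_elim \<alpha> \<beta>) \<gamma>" "composable \<alpha> (cut_elim \<beta> \<gamma>)"
    using \<alpha>\<beta> \<beta>\<gamma> by (auto simp: composable_def)
  then show "(a \<cdot>\<^bsub>Bif D C p\<^esub> b) \<cdot>\<^bsub>Bif D C p\<^esub> c = a \<cdot>\<^bsub>Bif D C p\<^esub> (b \<cdot>\<^bsub>Bif D C p\<^esub> c)"
    using \<alpha> \<beta> \<gamma> \<alpha>\<beta> \<beta>\<gamma> by (auto intro: cls_eqI cut_elim_assoc)
qed (auto simp: Hom_Bif)


section \<open>The free bifibration\<close>

lemma cat_functor_Lambda: "cat_functor (Bif D C p) C (Lambda C p)"
proof -
  interpret B: category "Bif D C p" by (rule category_Bif)
  show ?thesis
  proof
    fix a b S T U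
    assume "a \<in> Hom (Bif D C p) S T" "b \<in> Hom (Bif D C p) T U"
    then show "onArr (Lambda C p) (a \<cdot>\<^bsub>Bif D C p\<^esub> b) =
        onArr (Lambda C p) a \<cdot>\<^bsub>C\<^esub> onArr (Lambda C p) b"
      by (auto simp: Lambda_def Hom_Bif composableI)
  qed (auto simp: Lambda_def Hom_Bif C.Hom_iff)
qed

lemma onObj_Lambda [simp]: "onObj (Lambda C p) = base C p"
  and onArr_Lambda [simp]: "onArr (Lambda C p) = bover"
  by (simp_all add: Lambda_def)

lemma cleavage_simps [simp]:
  "push (Bif_cleavage D C p) = Push"
  "pull (Bif_cleavage D C p) = Pull"
  by (simp_all add: Bif_cleavage_def)

lemma pushArr_Bif [simp]:
  "is_formula S \<Longrightarrow> f \<in> Arr C \<Longrightarrow> Dom C f = base C p S \<Longrightarrow>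
    pushArr (Bif_cleavage D C p) f S = cls (RP f (id_deriv D C S))"
  by (simp add: Bif_cleavage_def class_of_eq_cls)

lemma pullArr_Bif [simp]:
  "is_formula T \<Longrightarrow> g \<in> Arr C \<Longrightarrow> Cod C g = base C p T \<Longrightarrow>
    pullArr (Bif_cleavage D C p) g T = cls (LM g (id_deriv D C T))"
  by (simp add: Bif_cleavage_def class_of_eq_cls)

text \<open>A derivation out of \<open>f\<^sup>+S\<close> is recovered by \<open>L\<^sup>+\<close> from its composite with the chosen lifting,
  because \<open>L\<^sup>+\<close> of that composite is its cut with the identity of \<open>f\<^sup>+S\<close>. Dually for \<open>R\<^sup>-\<close>.\<close>

lemma LP_unique:
  assumes "valid \<beta>" "src \<beta> = Push f S" "cut_elim (RP f (id_deriv D C S)) \<beta> \<approx> \<alpha>"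
  shows "LP f (over \<beta>) \<alpha> \<approx> \<beta>"
proof -
  have S: "is_formula S" "f \<in> Arr C" "Dom C f = base C p S" "Dom C (over \<beta>) = Cod C f"
    using assms is_formula_src[of \<beta>] base_src[of \<beta>] by auto
  have "LP f (over \<beta>) \<alpha> \<approx> LP f (over \<beta>) (cut_elim (RP f (id_deriv D C S)) \<beta>)"
    using assms S peqD[OF assms(3)] by (intro peq_LP[OF peq_sym]) (auto simp: composable_def)
  also have "\<dots> = cut_elim (id_deriv D C (Push f S)) \<beta>"
    using S assms(1) by simp
  also have "\<dots> \<approx> \<beta>" using assms by (intro cut_id_left) auto
  finally show ?thesis .
qed

lemma RM_unique:
  assumes "valid \<beta>" "tgt \<beta> = Pull g T" "cut_elim \<beta> (LM g (id_deriv D C T)) \<approx> \<alpha>"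
  shows "RM (over \<beta>) g \<alpha> \<approx> \<beta>"
proof -
  have T: "is_formula T" "g \<in> Arr C" "Cod C g = base C p T" "Cod C (over \<beta>) = Dom C g"
    using assms is_formula_tgt[of \<beta>] base_tgt[of \<beta>] by auto
  have "RM (over \<beta>) g \<alpha> \<approx> RM (over \<beta>) g (cut_elim \<beta> (LM g (id_deriv D C T)))"
    using assms T peqD[OF assms(3)] by (intro peq_RM[OF peq_sym]) (auto simp: composable_def)
  also have "\<dots> \<approx> cut_elim \<beta> (id_deriv D C (Pull g T))"
    unfolding id_deriv.simps
    using T assms(1,2) by (intro peq_sym[OF cut_elim_RM']) (auto simp: composable_def)
  also have "\<dots> \<approx> \<beta>" using assms by (intro cut_id_right) auto
  finally show ?thesis .
qed

text \<open>Each rule is composition with, or factorisation through, a chosen lifting.\<close>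

lemma composable_push:
  "valid (LP f g \<alpha>) \<Longrightarrow> composable (RP f (id_deriv D C (src \<alpha>))) (LP f g \<alpha>)"
  by (auto simp: composable_def)

lemma composable_pull:
  "valid (RM f g \<alpha>) \<Longrightarrow> composable (RM f g \<alpha>) (LM g (id_deriv D C (tgt \<alpha>)))"
  by (auto simp: composable_def)

lemma cls_LP:
  assumes "valid (LP f g \<alpha>)"
  shows "cls (RP f (id_deriv D C (src \<alpha>))) \<cdot>\<^bsub>Bif D C p\<^esub> cls (LP f g \<alpha>) = cls \<alpha>"
  using assms composable_push[OF assms] cls_eqI[OF cut_id_left[of \<alpha> "src \<alpha>"]] by simp

lemma cls_RM:
  assumes "valid (RM f g \<alpha>)"
  shows "cls (RM f g \<alpha>) \<cdot>\<^bsub>Bif D C p\<^esub> cls (LM g (id_deriv D C (tgt \<alpha>))) = cls \<alpha>"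
  using assms composable_pull[OF assms] cls_eqI[OF cut_id_right[of \<alpha> "tgt \<alpha>"]] by simp

lemma cls_RP:
  assumes "valid (RP f \<alpha>)"
  shows "cls \<alpha> \<cdot>\<^bsub>Bif D C p\<^esub> cls (RP f (id_deriv D C (tgt \<alpha>))) = cls (RP f \<alpha>)"
proof -
  have c: "composable \<alpha> (RP f (id_deriv D C (tgt \<alpha>)))"
    using assms by (auto simp: composable_def)
  have "cut_elim \<alpha> (RP f (id_deriv D C (tgt \<alpha>))) \<approx> RP f (cut_elim \<alpha> (id_deriv D C (tgt \<alpha>)))"
    using c by (rule cut_elim_RP)
  also have "\<dots> \<approx> RP f \<alpha>"
    using assms c by (intro peq_RP cut_id_right) (auto simp: composable_def)
  finally show ?thesis using c by (auto intro: cls_eqI)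
qed

lemma cls_LM:
  assumes "valid (LM g \<alpha>)"
  shows "cls (LM g (id_deriv D C (src \<alpha>))) \<cdot>\<^bsub>Bif D C p\<^esub> cls \<alpha> = cls (LM g \<alpha>)"
proof -
  have c: "composable (LM g (id_deriv D C (src \<alpha>))) \<alpha>"
    using assms by (auto simp: composable_def)
  then have "LM g (cut_elim (id_deriv D C (src \<alpha>)) \<alpha>) \<approx> LM g \<alpha>"
    using assms by (intro peq_LM cut_id_left) (auto simp: composable_def)
  then show ?thesis using c by (auto intro: cls_eqI)
qed

lemma bifibration_Bif: "bifibration (Bif D C p) C (Lambda C p) (Bif_cleavage D C p)"
proof -
  interpret L: cat_functor "Bif D C p" C "Lambda C p" by (rule cat_functor_Lambda)
  show ?thesis
  proof
    fix f A B S
    assume f: "f \<in> Hom C A B" and S: "S \<in> Obj (Bif D C p)" "onObj (Lambda C p) S = A"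
    show "push (Bif_cleavage D C p) f S \<in> Obj (Bif D C p) \<and>
        onObj (Lambda C p) (push (Bif_cleavage D C p) f S) = B"
      "pushArr (Bif_cleavage D C p) f S \<in> Hom (Bif D C p) S (push (Bif_cleavage D C p) f S) \<and>
        onArr (Lambda C p) (pushArr (Bif_cleavage D C p) f S) = f"
      using f S by (auto simp: Hom_Bif C.Hom_iff intro!: exI[of _ "RP f (id_deriv D C S)"])
    fix g B' a T
    assume g: "g \<in> Hom C B B'" and a: "a \<in> Hom (Bif D C p) S T"
      "onArr (Lambda C p) a = f \<cdot>\<^bsub>C\<^esub> g"
    then obtain \<alpha> where \<alpha>: "a = cls \<alpha>" "valid \<alpha>" "src \<alpha> = S" "tgt \<alpha> = T" "over \<alpha> = f \<cdot>\<^bsub>C\<^esub> g"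
      by (auto simp: Hom_Bif)
    have c: "composable (id_deriv D C S) \<alpha>" using \<alpha> S by (auto intro: composableI)
    show "\<exists>!b. b \<in> Hom (Bif D C p) (push (Bif_cleavage D C p) f S) T \<and> onArr (Lambda C p) b = g \<and>
        a = pushArr (Bif_cleavage D C p) f S \<cdot>\<^bsub>Bif D C p\<^esub> b"
    proof (rule ex1I[of _ "cls (LP f g \<alpha>)"])
      show "cls (LP f g \<alpha>) \<in> Hom (Bif D C p) (push (Bif_cleavage D C p) f S) T \<and>
          onArr (Lambda C p) (cls (LP f g \<alpha>)) = g \<and>
          a = pushArr (Bif_cleavage D C p) f S \<cdot>\<^bsub>Bif D C p\<^esub> cls (LP f g \<alpha>)"
      proof (intro conjI)
        have "valid (LP f g \<alpha>)" using \<alpha> f g by (simp add: C.Hom_iff)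
        then show "cls (LP f g \<alpha>) \<in> Hom (Bif D C p) (push (Bif_cleavage D C p) f S) T"
          unfolding Hom_Bif using \<alpha> by force
        have "composable (RP f (id_deriv D C S)) (LP f g \<alpha>)"
          using \<alpha> f g S c base_Obj[of S] by (simp add: C.Hom_iff)
        then show "a = pushArr (Bif_cleavage D C p) f S \<cdot>\<^bsub>Bif D C p\<^esub> cls (LP f g \<alpha>)"
          using \<alpha> f S cls_eqI[OF cut_id_left[of \<alpha> S]] by (simp add: C.Hom_iff)
      qed simp
    next
      fix b
      assume b: "b \<in> Hom (Bif D C p) (push (Bif_cleavage D C p) f S) T \<and> onArr (Lambda C p) b = g \<and>
        a = pushArr (Bif_cleavage D C p) f S \<cdot>\<^bsub>Bif D C p\<^esub> b"
      then obtain \<beta> where \<beta>: "b = cls \<beta>" "valid \<beta>" "src \<beta> = Push f S" "over \<beta> = g"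
        by (auto simp: Hom_Bif)
      have "composable (RP f (id_deriv D C S)) \<beta>"
        using \<beta> f S by (intro composableI) (auto simp: C.Hom_iff)
      then have "cut_elim (RP f (id_deriv D C S)) \<beta> \<approx> \<alpha>"
        using b \<alpha> \<beta> f S by (auto simp: C.Hom_iff cls_eq_iff intro: peq_sym)
      then show "b = cls (LP f g \<alpha>)"
        using LP_unique[OF \<beta>(2,3)] \<beta> by (auto intro: cls_eqI peq_sym)
    qed
  next
    fix g B B' T
    assume g: "g \<in> Hom C B B'" and T: "T \<in> Obj (Bif D C p)" "onObj (Lambda C p) T = B'"
    show "pull (Bif_cleavage D C p) g T \<in> Obj (Bif D C p) \<and>
        onObj (Lambda C p) (pull (Bif_cleavage D C p) g T) = B"
      "pullArr (Bif_cleavage D C p) g T \<in> Hom (Bif D C p) (pull (Bif_cleavage D C p) g T) T \<and>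
        onArr (Lambda C p) (pullArr (Bif_cleavage D C p) g T) = g"
      using g T by (auto simp: Hom_Bif C.Hom_iff intro!: exI[of _ "LM g (id_deriv D C T)"])
    fix f A a S
    assume f: "f \<in> Hom C A B" and a: "a \<in> Hom (Bif D C p) S T"
      "onArr (Lambda C p) a = f \<cdot>\<^bsub>C\<^esub> g"
    then obtain \<alpha> where \<alpha>: "a = cls \<alpha>" "valid \<alpha>" "src \<alpha> = S" "tgt \<alpha> = T" "over \<alpha> = f \<cdot>\<^bsub>C\<^esub> g"
      by (auto simp: Hom_Bif)
    have c: "composable \<alpha> (id_deriv D C T)" using \<alpha> T by (auto intro: composableI)
    show "\<exists>!b. b \<in> Hom (Bif D C p) S (pull (Bif_cleavage D C p) g T) \<and> onArr (Lambda C p) b = f \<and>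
        a = b \<cdot>\<^bsub>Bif D C p\<^esub> pullArr (Bif_cleavage D C p) g T"
    proof (rule ex1I[of _ "cls (RM f g \<alpha>)"])
      show "cls (RM f g \<alpha>) \<in> Hom (Bif D C p) S (pull (Bif_cleavage D C p) g T) \<and>
          onArr (Lambda C p) (cls (RM f g \<alpha>)) = f \<and>
          a = cls (RM f g \<alpha>) \<cdot>\<^bsub>Bif D C p\<^esub> pullArr (Bif_cleavage D C p) g T"
      proof (intro conjI)
        have "valid (RM f g \<alpha>)" using \<alpha> f g by (simp add: C.Hom_iff)
        then show "cls (RM f g \<alpha>) \<in> Hom (Bif D C p) S (pull (Bif_cleavage D C p) g T)"
          unfolding Hom_Bif using \<alpha> by force
        have "composable (RM f g \<alpha>) (LM g (id_deriv D C T))"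
          using \<alpha> f g T c base_Obj[of T] by (simp add: C.Hom_iff)
        then show "a = cls (RM f g \<alpha>) \<cdot>\<^bsub>Bif D C p\<^esub> pullArr (Bif_cleavage D C p) g T"
          using \<alpha> g T cls_eqI[OF cut_id_right[of \<alpha> T]] by (simp add: C.Hom_iff)
      qed simp
    next
      fix b
      assume b: "b \<in> Hom (Bif D C p) S (pull (Bif_cleavage D C p) g T) \<and> onArr (Lambda C p) b = f \<and>
        a = b \<cdot>\<^bsub>Bif D C p\<^esub> pullArr (Bif_cleavage D C p) g T"
      then obtain \<beta> where \<beta>: "b = cls \<beta>" "valid \<beta>" "tgt \<beta> = Pull g T" "over \<beta> = f"
        by (auto simp: Hom_Bif)
      have "composable \<beta> (LM g (id_deriv D C T))"
        using \<beta> g T by (intro composableI) (auto simp: C.Hom_iff)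
      then have "cut_elim \<beta> (LM g (id_deriv D C T)) \<approx> \<alpha>"
        using b \<alpha> \<beta> g T by (auto simp: C.Hom_iff cls_eq_iff intro: peq_sym)
      then show "b = cls (RM f g \<alpha>)"
        using RM_unique[OF \<beta>(2,3)] \<beta> by (auto intro: cls_eqI peq_sym)
    qed
  qed
qed

lemma onObj_eta [simp]: "onObj (eta D C p) = Atom"
  by (simp add: eta_def)

lemma onArr_eta [simp]: "onArr (eta D C p) \<delta> = cls (Ax \<delta>)"
  by (simp add: eta_def class_of_eq_cls)

lemma cat_functor_eta: "cat_functor D (Bif D C p) (eta D C p)"
proof -
  interpret B: category "Bif D C p" by (rule category_Bif)
  show ?thesis
  proof
    fix X Y Z \<delta> \<epsilon>
    assume "\<delta> \<in> Hom D X Y" "\<epsilon> \<in> Hom D Y Z"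
    then show "onArr (eta D C p) (\<delta> \<cdot>\<^bsub>D\<^esub> \<epsilon>) =
        onArr (eta D C p) \<delta> \<cdot>\<^bsub>Bif D C p\<^esub> onArr (eta D C p) \<epsilon>"
      by (auto simp: D.Hom_iff)
  qed (auto simp: Hom_Bif D.Hom_iff)
qed

lemma Lambda_eta: "functor_eq D (functor_comp (Lambda C p) (eta D C p)) p"
  by (simp add: functor_eq_def functor_comp_def)

end


section \<open>Factorisations through chosen liftings\<close>

context bifibration
begin

text \<open>\<open>push_factor f S g a\<close> is the unique \<open>b\<close> over \<open>g\<close> with \<open>a = f\<^sub>S b\<close>, and \<open>pull_factor f g T a\<close>
  is the unique \<open>b\<close> over \<open>f\<close> whose composite with the chosen lifting of \<open>g\<close> at \<open>T\<close> is \<open>a\<close>.\<close>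

definition push_factor :: "'a \<Rightarrow> 'y \<Rightarrow> 'a \<Rightarrow> 'e \<Rightarrow> 'e" where
  "push_factor f S g a = (THE b. b \<in> Hom E (push K f S) (Cod E a) \<and> onArr q b = g \<and>
     a = pushArr K f S \<cdot>\<^bsub>E\<^esub> b)"

definition pull_factor :: "'a \<Rightarrow> 'a \<Rightarrow> 'y \<Rightarrow> 'e \<Rightarrow> 'e" where
  "pull_factor f g T a = (THE b. b \<in> Hom E (Dom E a) (pull K g T) \<and> onArr q b = f \<and>
     a = b \<cdot>\<^bsub>E\<^esub> pullArr K g T)"

lemma push_simps [simp]:
  assumes "f \<in> Arr C" "S \<in> Obj E" "onObj q S = Dom C f"
  shows "push K f S \<in> Obj E" "onObj q (push K f S) = Cod C f" "pushArr K f S \<in> Arr E"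
    "Dom E (pushArr K f S) = S" "Cod E (pushArr K f S) = push K f S" "onArr q (pushArr K f S) = f"
  using push_Obj[of f "Dom C f" "Cod C f" S] pushArr_Hom[of f "Dom C f" "Cod C f" S] assms
  by (auto simp: Hom_def)

lemma pull_simps [simp]:
  assumes "g \<in> Arr C" "T \<in> Obj E" "onObj q T = Cod C g"
  shows "pull K g T \<in> Obj E" "onObj q (pull K g T) = Dom C g" "pullArr K g T \<in> Arr E"
    "Dom E (pullArr K g T) = pull K g T" "Cod E (pullArr K g T) = T" "onArr q (pullArr K g T) = g"
  using pull_Obj[of g "Dom C g" "Cod C g" T] pullArr_Hom[of g "Dom C g" "Cod C g" T] assms
  by (auto simp: Hom_def)

lemma push_factor_ex1:
  assumes "f \<in> Arr C" "g \<in> Arr C" "Cod C f = Dom C g" "a \<in> Arr E"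
    "onArr q a = f \<cdot>\<^bsub>C\<^esub> g" "S = Dom E a"
  shows "\<exists>!b. b \<in> Hom E (push K f S) (Cod E a) \<and> onArr q b = g \<and> a = pushArr K f S \<cdot>\<^bsub>E\<^esub> b"
proof -
  have "onObj q S = Dom C f"
    using onArr_simps(2)[OF assms(4)] assms by simp
  then show ?thesis
    using pushArr_universal[of f "Dom C f" "Cod C f" S g "Cod C g" a "Cod E a"] assms
    by (simp add: Hom_def)
qed

lemma pull_factor_ex1:
  assumes "f \<in> Arr C" "g \<in> Arr C" "Cod C f = Dom C g" "a \<in> Arr E"
    "onArr q a = f \<cdot>\<^bsub>C\<^esub> g" "T = Cod E a"
  shows "\<exists>!b. b \<in> Hom E (Dom E a) (pull K g T) \<and> onArr q b = f \<and> a = b \<cdot>\<^bsub>E\<^esub> pullArr K g T"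
proof -
  have "onObj q T = Cod C g"
    using onArr_simps(3)[OF assms(4)] assms by simp
  then show ?thesis
    using pullArr_universal[of g "Dom C g" "Cod C g" T f "Dom C f" a "Dom E a"] assms
    by (simp add: Hom_def)
qed

lemma push_factor:
  assumes "f \<in> Arr C" "g \<in> Arr C" "Cod C f = Dom C g" "a \<in> Arr E"
    "onArr q a = f \<cdot>\<^bsub>C\<^esub> g" "S = Dom E a"
  shows "push_factor f S g a \<in> Arr E" "Dom E (push_factor f S g a) = push K f S"
    "Cod E (push_factor f S g a) = Cod E a" "onArr q (push_factor f S g a) = g"
    "pushArr K f S \<cdot>\<^bsub>E\<^esub> push_factor f S g a = a"
  using theI'[OF push_factor_ex1[OF assms], folded push_factor_def] by (auto simp: Hom_def)

lemma pull_factor: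
  assumes "f \<in> Arr C" "g \<in> Arr C" "Cod C f = Dom C g" "a \<in> Arr E"
    "onArr q a = f \<cdot>\<^bsub>C\<^esub> g" "T = Cod E a"
  shows "pull_factor f g T a \<in> Arr E" "Cod E (pull_factor f g T a) = pull K g T"
    "Dom E (pull_factor f g T a) = Dom E a" "onArr q (pull_factor f g T a) = f"
    "pull_factor f g T a \<cdot>\<^bsub>E\<^esub> pullArr K g T = a"
  using theI'[OF pull_factor_ex1[OF assms], folded pull_factor_def] by (auto simp: Hom_def)

lemma push_factor_eqI:
  assumes "f \<in> Arr C" "Cod C f = Dom C g" "g \<in> Arr C" "S \<in> Obj E" "onObj q S = Dom C f"
    "b \<in> Arr E" "Dom E b = push K f S" "onArr q b = g" "a = pushArr K f S \<cdot>\<^bsub>E\<^esub> b"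
  shows "push_factor f S g a = b"
proof -
  have "\<exists>!b. b \<in> Hom E (push K f S) (Cod E a) \<and> onArr q b = g \<and> a = pushArr K f S \<cdot>\<^bsub>E\<^esub> b"
    using assms by (intro push_factor_ex1) (auto simp: onArr_seq)
  then show ?thesis
    unfolding push_factor_def using assms by (intro the1_equality) (auto simp: Hom_def)
qed

lemma pull_factor_eqI:
  assumes "f \<in> Arr C" "Cod C f = Dom C g" "g \<in> Arr C" "T \<in> Obj E" "onObj q T = Cod C g"
    "b \<in> Arr E" "Cod E b = pull K g T" "onArr q b = f" "a = b \<cdot>\<^bsub>E\<^esub> pullArr K g T"
  shows "pull_factor f g T a = b"
proof -
  have "\<exists>!b. b \<in> Hom E (Dom E a) (pull K g T) \<and> onArr q b = f \<and> a = b \<cdot>\<^bsub>E\<^esub> pullArr K g T"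
    using assms by (intro pull_factor_ex1) (auto simp: onArr_seq)
  then show ?thesis
    unfolding pull_factor_def using assms by (intro the1_equality) (auto simp: Hom_def)
qed

end


section \<open>Interpretation in a bifibration\<close>

text \<open>A functor \<open>\<theta>\<close> over the base from \<open>p\<close> to a bifibration \<open>q\<close>.\<close>

locale sequent_interpretation =
    sequent_calculus D C p + E: bifibration E C q K + th: cat_functor D E \<theta>
  for D :: "('x, 'd) cat" and C :: "('o, 'a) cat" and p :: "('x, 'd, 'o, 'a) functr"
    and E :: "('y, 'e) cat" and q :: "('y, 'e, 'o, 'a) functr" and K :: "('y, 'e, 'a) cleavage"
    and \<theta> :: "('x, 'd, 'y, 'e) functr" +
  assumes over_p: "functor_eq D (functor_comp q \<theta>) p"
begin

lemma q_th [simp]: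
  "X \<in> Obj D \<Longrightarrow> onObj q (onObj \<theta> X) = onObj p X"
  "\<delta> \<in> Arr D \<Longrightarrow> onArr q (onArr \<theta> \<delta>) = onArr p \<delta>"
  using over_p by (auto simp: functor_eq_def functor_comp_def)

primrec interp_obj :: "('x, 'a) formula \<Rightarrow> 'y" where
  "interp_obj (Atom X) = onObj \<theta> X"
| "interp_obj (Push f S) = push K f (interp_obj S)"
| "interp_obj (Pull g T) = pull K g (interp_obj T)"

text \<open>The interpretation is defined on raw derivations and is meaningful on the valid ones.\<close>

primrec interp :: "('d, 'a) derivation \<Rightarrow> 'e" where
  "interp (Ax \<delta>) = onArr \<theta> \<delta>"
| "interp (LP f g \<alpha>) = E.push_factor f (interp_obj (src \<alpha>)) g (interp \<alpha>)"
| "interp (RP f \<alpha>) = interp \<alpha> \<cdot>\<^bsub>E\<^esub> pushArr K f (interp_obj (tgt \<alpha>))"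
| "interp (LM g \<alpha>) = pullArr K g (interp_obj (src \<alpha>)) \<cdot>\<^bsub>E\<^esub> interp \<alpha>"
| "interp (RM f g \<alpha>) = E.pull_factor f g (interp_obj (tgt \<alpha>)) (interp \<alpha>)"

lemma interp_obj [simp]:
  assumes "is_formula S"
  shows "interp_obj S \<in> Obj E" "onObj q (interp_obj S) = base C p S"
  using assms by (induction S) (auto simp: th.onObj_Obj)

lemma interp_typing:
  "valid \<alpha> \<Longrightarrow> interp \<alpha> \<in> Arr E \<and> Dom E (interp \<alpha>) = interp_obj (src \<alpha>) \<and>
    Cod E (interp \<alpha>) = interp_obj (tgt \<alpha>) \<and> onArr q (interp \<alpha>) = over \<alpha>"
  by (induction \<alpha>) (auto simp: E.push_factor E.pull_factor E.onArr_seq)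

lemma interp_simps [simp]:
  assumes "valid \<alpha>"
  shows "interp \<alpha> \<in> Arr E" "Dom E (interp \<alpha>) = interp_obj (src \<alpha>)"
    "Cod E (interp \<alpha>) = interp_obj (tgt \<alpha>)" "onArr q (interp \<alpha>) = over \<alpha>"
  using interp_typing[OF assms] by auto

lemma interp_LP:
  assumes "valid (LP f g \<alpha>)"
  obtains b where "interp (LP f g \<alpha>) = b" "b \<in> Arr E" "Dom E b = push K f (interp_obj (src \<alpha>))"
    "Cod E b = interp_obj (tgt \<alpha>)" "onArr q b = g"
    "interp \<alpha> = pushArr K f (interp_obj (src \<alpha>)) \<cdot>\<^bsub>E\<^esub> b"
  using assms E.push_factor[of f g "interp \<alpha>" "interp_obj (src \<alpha>)"]
  by (intro that[OF HOL.refl]) simp_all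

lemma interp_RM:
  assumes "valid (RM f g \<alpha>)"
  obtains b where "interp (RM f g \<alpha>) = b" "b \<in> Arr E" "Cod E b = pull K g (interp_obj (tgt \<alpha>))"
    "Dom E b = interp_obj (src \<alpha>)" "onArr q b = f"
    "interp \<alpha> = b \<cdot>\<^bsub>E\<^esub> pullArr K g (interp_obj (tgt \<alpha>))"
  using assms E.pull_factor[of f g "interp \<alpha>" "interp_obj (tgt \<alpha>)"]
  by (intro that[OF HOL.refl]) simp_all

lemma interp_LP_eqI:
  assumes "valid (LP f g \<alpha>)" "b \<in> Arr E" "Dom E b = push K f (interp_obj (src \<alpha>))" "onArr q b = g"
    "interp \<alpha> = pushArr K f (interp_obj (src \<alpha>)) \<cdot>\<^bsub>E\<^esub> b"
  shows "interp (LP f g \<alpha>) = b"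
  using assms E.push_factor_eqI[of f g "interp_obj (src \<alpha>)" b "interp \<alpha>"] by simp

lemma interp_RM_eqI:
  assumes "valid (RM f g \<alpha>)" "b \<in> Arr E" "Cod E b = pull K g (interp_obj (tgt \<alpha>))" "onArr q b = f"
    "interp \<alpha> = b \<cdot>\<^bsub>E\<^esub> pullArr K g (interp_obj (tgt \<alpha>))"
  shows "interp (RM f g \<alpha>) = b"
  using assms E.pull_factor_eqI[of f g "interp_obj (tgt \<alpha>)" b "interp \<alpha>"] by simp

declare interp.simps(2,5) [simp del]

lemma interp_peq: "\<alpha> \<approx> \<beta> \<Longrightarrow> interp \<alpha> = interp \<beta>"
proof (induction rule: peq_induct)
  case (RP_LM h f \<alpha>)
  then show ?case by simp
next
  case (RP_LP h f g \<alpha>)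
  then have "valid (LP f g \<alpha>)" by simp
  then obtain b where b: "interp (LP f g \<alpha>) = b" "b \<in> Arr E"
    "Dom E b = push K f (interp_obj (src \<alpha>))" "Cod E b = interp_obj (tgt \<alpha>)" "onArr q b = g"
    "interp \<alpha> = pushArr K f (interp_obj (src \<alpha>)) \<cdot>\<^bsub>E\<^esub> b"
    by (rule interp_LP)
  have "interp (LP f (g \<cdot>\<^bsub>C\<^esub> h) (RP h \<alpha>)) = b \<cdot>\<^bsub>E\<^esub> pushArr K h (interp_obj (tgt \<alpha>))"
    using RP_LP b by (intro interp_LP_eqI) (simp_all add: E.onArr_seq)
  then show ?case using b by simp
next
  case (RM_LM f g h \<alpha>)
  then have "valid (RM g h \<alpha>)" by simp
  then obtain b where b: "interp (RM g h \<alpha>) = b" "b \<in> Arr E"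
    "Cod E b = pull K h (interp_obj (tgt \<alpha>))" "Dom E b = interp_obj (src \<alpha>)" "onArr q b = g"
    "interp \<alpha> = b \<cdot>\<^bsub>E\<^esub> pullArr K h (interp_obj (tgt \<alpha>))"
    by (rule interp_RM)
  have "interp (RM (f \<cdot>\<^bsub>C\<^esub> g) h (LM f \<alpha>)) = pullArr K f (interp_obj (src \<alpha>)) \<cdot>\<^bsub>E\<^esub> b"
    using RM_LM b by (intro interp_RM_eqI) (simp_all add: E.onArr_seq)
  then show ?case using b by simp
next
  case (RM_LP f g h \<alpha>)
  then have v: "valid \<alpha>" "f \<in> Arr C" "g \<in> Arr C" "h \<in> Arr C" "Cod C f = Dom C g"
    "Cod C g = Dom C h" "over \<alpha> = (f \<cdot>\<^bsub>C\<^esub> g) \<cdot>\<^bsub>C\<^esub> h"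
    by auto
  from RM_LP have "valid (RM (f \<cdot>\<^bsub>C\<^esub> g) h \<alpha>)" by simp
  then obtain b where b: "interp (RM (f \<cdot>\<^bsub>C\<^esub> g) h \<alpha>) = b"
    "interp \<alpha> = b \<cdot>\<^bsub>E\<^esub> pullArr K h (interp_obj (tgt \<alpha>))"
    by (rule interp_RM)
  let ?\<beta> = "RM (f \<cdot>\<^bsub>C\<^esub> g) h \<alpha>"
  obtain c where c: "interp (LP f g ?\<beta>) = c" "c \<in> Arr E"
    "Dom E c = push K f (interp_obj (src ?\<beta>))" "Cod E c = interp_obj (tgt ?\<beta>)"
    "onArr q c = g" "interp ?\<beta> = pushArr K f (interp_obj (src ?\<beta>)) \<cdot>\<^bsub>E\<^esub> c"
    by (rule interp_LP[OF RM_LP])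
  have bc: "b = pushArr K f (interp_obj (src \<alpha>)) \<cdot>\<^bsub>E\<^esub> c" using b(1) c(6) by simp
  have "interp (LP f (g \<cdot>\<^bsub>C\<^esub> h) \<alpha>) = c \<cdot>\<^bsub>E\<^esub> pullArr K h (interp_obj (tgt \<alpha>))"
    using v b(2) bc c(2-5) by (intro interp_LP_eqI) (simp_all add: E.onArr_seq)
  then have "interp (RM g h (LP f (g \<cdot>\<^bsub>C\<^esub> h) \<alpha>)) = c"
    using v c(2-5) by (intro interp_RM_eqI) simp_all
  then show ?case using c(1) by simp
next
  case (LP f g \<alpha> \<beta>)
  then show ?case using peqD[OF LP(1)] by (simp add: interp.simps)
next
  case (RM f g \<alpha> \<beta>)
  then show ?case using peqD[OF RM(1)] by (simp add: interp.simps)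
next
  case (RP f \<alpha> \<beta>)
  then show ?case using peqD[OF RP(1)] by simp
next
  case (LM g \<alpha> \<beta>)
  then show ?case using peqD[OF LM(1)] by simp
qed simp_all

lemma interp_cut_RP:
  assumes "composable \<alpha> (RP f \<beta>)" "interp (cut_elim \<alpha> \<beta>) = interp \<alpha> \<cdot>\<^bsub>E\<^esub> interp \<beta>"
  shows "interp (RP f (cut_elim \<alpha> \<beta>)) = interp \<alpha> \<cdot>\<^bsub>E\<^esub> interp (RP f \<beta>)"
proof -
  have c: "composable \<alpha> \<beta>" using assms by simp
  then show ?thesis using assms composableD[OF c] by simp
qed

lemma interp_cut_RM:
  assumes "composable \<alpha> (RM h f \<beta>)" "interp (cut_elim \<alpha> \<beta>) = interp \<alpha> \<cdot>\<^bsub>E\<^esub> interp \<beta>"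
  shows "interp (RM (over \<alpha> \<cdot>\<^bsub>C\<^esub> h) f (cut_elim \<alpha> \<beta>)) = interp \<alpha> \<cdot>\<^bsub>E\<^esub> interp (RM h f \<beta>)"
proof -
  have c: "composable \<alpha> \<beta>" using assms by simp
  have "valid (RM h f \<beta>)" using assms by simp
  then obtain b where b: "interp (RM h f \<beta>) = b" "b \<in> Arr E"
    "Cod E b = pull K f (interp_obj (tgt \<beta>))" "Dom E b = interp_obj (src \<beta>)" "onArr q b = h"
    "interp \<beta> = b \<cdot>\<^bsub>E\<^esub> pullArr K f (interp_obj (tgt \<beta>))"
    by (rule interp_RM)
  have "interp (RM (over \<alpha> \<cdot>\<^bsub>C\<^esub> h) f (cut_elim \<alpha> \<beta>)) = interp \<alpha> \<cdot>\<^bsub>E\<^esub> b"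
    using assms b c composableD[OF c] by (intro interp_RM_eqI) (simp_all add: E.onArr_seq)
  then show ?thesis using b by simp
qed

lemma interp_cut_elim:
  "composable \<alpha> \<beta> \<Longrightarrow> interp (cut_elim \<alpha> \<beta>) = interp \<alpha> \<cdot>\<^bsub>E\<^esub> interp \<beta>"
proof (induction \<alpha> \<beta> rule: cut_elim.induct)
  case (1 f g \<alpha> \<beta>)
  then have v: "valid (LP f g \<alpha>)" "composable \<alpha> \<beta>" by auto
  then obtain b where b: "interp (LP f g \<alpha>) = b" "b \<in> Arr E"
    "Dom E b = push K f (interp_obj (src \<alpha>))" "Cod E b = interp_obj (tgt \<alpha>)" "onArr q b = g"
    "interp \<alpha> = pushArr K f (interp_obj (src \<alpha>)) \<cdot>\<^bsub>E\<^esub> b"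
    using interp_LP by blast
  have "interp (LP f (g \<cdot>\<^bsub>C\<^esub> over \<beta>) (cut_elim \<alpha> \<beta>)) = b \<cdot>\<^bsub>E\<^esub> interp \<beta>"
    using v b 1 composableD[OF v(2)] by (intro interp_LP_eqI) (simp_all add: E.onArr_seq)
  then show ?case using b by simp
next
  case (2 f \<alpha> \<beta>)
  then have "composable \<alpha> \<beta>" by auto
  then show ?case using 2 composableD[of \<alpha> \<beta>] by simp
next
  case (5 f \<alpha> f' h \<beta>)
  then have c: "composable \<alpha> \<beta>" "f' = f" "valid (RP f \<alpha>)" "valid (LP f h \<beta>)" by auto
  obtain b where b: "interp (LP f h \<beta>) = b" "b \<in> Arr E"
    "Dom E b = push K f (interp_obj (src \<beta>))" "Cod E b = interp_obj (tgt \<beta>)" "onArr q b = h"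
    "interp \<beta> = pushArr K f (interp_obj (src \<beta>)) \<cdot>\<^bsub>E\<^esub> b"
    by (rule interp_LP[OF c(4)])
  then show ?case using 5 c composableD[OF c(1)] by simp
next
  case (6 g f \<alpha> f' \<beta>)
  then have c: "composable \<alpha> \<beta>" "f' = f" "valid (RM g f \<alpha>)" "valid (LM f \<beta>)" by auto
  obtain b where b: "interp (RM g f \<alpha>) = b" "b \<in> Arr E"
    "Cod E b = pull K f (interp_obj (tgt \<alpha>))" "Dom E b = interp_obj (src \<alpha>)" "onArr q b = g"
    "interp \<alpha> = b \<cdot>\<^bsub>E\<^esub> pullArr K f (interp_obj (tgt \<alpha>))"
    by (rule interp_RM[OF c(3)])
  then show ?case using 6 c composableD[OF c(1)] by simp
qed (simp_all add: interp_cut_RP interp_cut_RM th.onArr_seq del: interp.simps(3) over.simps)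

lemma interp_id: "is_formula S \<Longrightarrow> interp (id_deriv D C S) = Idn E (interp_obj S)"
proof (induction S)
  case (Atom X)
  then show ?case by (simp add: th.onArr_Idn)
next
  case (Push f S)
  then show ?case unfolding id_deriv.simps interp_obj.simps
    by (intro interp_LP_eqI) (simp_all add: E.onArr_Idn)
next
  case (Pull g T)
  then show ?case unfolding id_deriv.simps interp_obj.simps
    by (intro interp_RM_eqI) (simp_all add: E.onArr_Idn)
qed

text \<open>The induced functor on \<open>Bif\<close>. By invariance under permutation the choice of a representing
  derivation does not matter (\<open>onArr_interp_functor\<close>).\<close>

definition interp_functor :: "(('x, 'a) formula, ('x, 'd, 'a) bif_arrow, 'y, 'e) functr" where
  "interp_functor = \<lparr>onObj = interp_obj, onArr = \<lambda>a. interp (SOME \<alpha>. valid \<alpha> \<and> a = cls \<alpha>)\<rparr>"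

lemma onObj_interp_functor [simp]: "onObj interp_functor = interp_obj"
  by (simp add: interp_functor_def)

lemma onArr_interp_functor [simp]:
  assumes "valid \<alpha>"
  shows "onArr interp_functor (cls \<alpha>) = interp \<alpha>"
proof -
  define \<beta> where "\<beta> = (SOME \<beta>. valid \<beta> \<and> cls \<alpha> = cls \<beta>)"
  have "valid \<beta> \<and> cls \<alpha> = cls \<beta>"
    unfolding \<beta>_def by (rule someI[of _ \<alpha>]) (use assms in blast)
  then have "\<alpha> \<approx> \<beta>" using cls_eq_iff by blast
  then show ?thesis by (simp add: interp_functor_def \<beta>_def[symmetric] interp_peq)
qed

lemma bifibration_morphism_interp:
  "bifibration_morphism (Bif D C p) E C (Lambda C p) (Bif_cleavage D C p) q K interp_functor"
proof -
  interpret B: bifibration "Bif D C p" C "Lambda C p" "Bif_cleavage D C p" by (rule bifibration_Bif)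
  show ?thesis
  proof
    fix a b S T U
    assume "a \<in> Hom (Bif D C p) S T" "b \<in> Hom (Bif D C p) T U"
    then obtain \<alpha> \<beta> where "a = cls \<alpha>" "valid \<alpha>" "b = cls \<beta>" "valid \<beta>" "composable \<alpha> \<beta>"
      by (auto simp: Hom_Bif composableI)
    then show "onArr interp_functor (a \<cdot>\<^bsub>Bif D C p\<^esub> b) =
        onArr interp_functor a \<cdot>\<^bsub>E\<^esub> onArr interp_functor b"
      by (simp add: interp_cut_elim)
  next
    show "functor_eq (Bif D C p) (functor_comp q interp_functor) (Lambda C p)"
      by (auto simp: functor_eq_def functor_comp_def)
  next
    fix f A B S
    assume "f \<in> Hom C A B" "S \<in> Obj (Bif D C p)" "onObj (Lambda C p) S = A"
    then show "onArr interp_functor (pushArr (Bif_cleavage D C p) f S) =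
        pushArr K f (onObj interp_functor S)"
      using base_Obj[of S] by (simp add: C.Hom_iff interp_id)
  next
    fix g B B' T
    assume "g \<in> Hom C B B'" "T \<in> Obj (Bif D C p)" "onObj (Lambda C p) T = B'"
    then show "onArr interp_functor (pullArr (Bif_cleavage D C p) g T) =
        pullArr K g (onObj interp_functor T)"
      using base_Obj[of T] by (simp add: C.Hom_iff interp_id)
  qed (auto simp: Hom_Bif E.D.Hom_iff interp_id)
qed

lemma interp_functor_eta: "functor_eq D (functor_comp interp_functor (eta D C p)) \<theta>"
  by (simp add: functor_eq_def functor_comp_def)

lemma interp_functor_unique:
  assumes "bifibration_morphism (Bif D C p) E C (Lambda C p) (Bif_cleavage D C p) q K F"
    and "functor_eq D (functor_comp F (eta D C p)) \<theta>"
  shows "functor_eq (Bif D C p) F interp_functor"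
proof -
  interpret F: bifibration_morphism "Bif D C p" E C "Lambda C p" "Bif_cleavage D C p" q K F
    by (rule assms(1))
  have F_eta: "onObj F (Atom X) = onObj \<theta> X" if "X \<in> Obj D" for X
    using assms(2) that by (simp add: functor_eq_def functor_comp_def)
  have F_eta': "onArr F (cls (Ax \<delta>)) = onArr \<theta> \<delta>" if "\<delta> \<in> Arr D" for \<delta>
    using assms(2) that by (simp add: functor_eq_def functor_comp_def)
  have F_cls: "onArr F (cls \<alpha>) \<in> Arr E" "Dom E (onArr F (cls \<alpha>)) = onObj F (src \<alpha>)"
    "Cod E (onArr F (cls \<alpha>)) = onObj F (tgt \<alpha>)" if "valid \<alpha>" for \<alpha>
    using F.onArr_simps[OF cls_Arr[OF that]] by simp_all
  have F_over: "onArr q (onArr F (cls \<alpha>)) = over \<alpha>" if "valid \<alpha>" for \<alpha>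
    using cls_Arr[OF that] F.over_base unfolding functor_eq_def functor_comp_def by force
  have F_push: "onArr F (cls (RP f (id_deriv D C S))) = pushArr K f (onObj F S)"
    if "is_formula S" "f \<in> Arr C" "Dom C f = base C p S" for f S
    using F.preserves_pushArr[of f "Dom C f" "Cod C f" S] that by (simp add: C.Hom_iff)
  have F_pull: "onArr F (cls (LM g (id_deriv D C T))) = pullArr K g (onObj F T)"
    if "is_formula T" "g \<in> Arr C" "Cod C g = base C p T" for g T
    using F.preserves_pullArr[of g "Dom C g" "Cod C g" T] that by (simp add: C.Hom_iff)
  have F_comp: "onArr F (cls \<alpha> \<cdot>\<^bsub>Bif D C p\<^esub> cls \<beta>) = onArr F (cls \<alpha>) \<cdot>\<^bsub>E\<^esub> onArr F (cls \<beta>)"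
    if "composable \<alpha> \<beta>" for \<alpha> \<beta>
    using composableD[OF that] by (intro F.onArr_seq cls_Arr) simp_all
  have obj: "onObj F S = interp_obj S" if "is_formula S" for S
    using that
  proof (induction S)
    case (Atom X)
    then show ?case by (simp add: F_eta)
  next
    case (Push f S)
    then have S: "is_formula S" "f \<in> Arr C" "Dom C f = base C p S" by auto
    have "Cod E (onArr F (cls (RP f (id_deriv D C S)))) = onObj F (Push f S)"
      using S base_Obj[of S] by (subst F_cls) auto
    then show ?case using S Push F_push[OF S] by simp
  next
    case (Pull g T)
    then have T: "is_formula T" "g \<in> Arr C" "Cod C g = base C p T" by auto
    have "Dom E (onArr F (cls (LM g (id_deriv D C T)))) = onObj F (Pull g T)"
      using T base_Obj[of T] by (subst F_cls) auto
    then show ?case using T Pull F_pull[OF T] by simp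
  qed
  have arr: "onArr F (cls \<alpha>) = interp \<alpha>" if "valid \<alpha>" for \<alpha>
    using that
  proof (induction \<alpha>)
    case (Ax \<delta>)
    then show ?case by (simp add: F_eta')
  next
    case (LP f g \<alpha>)
    then have f: "is_formula (src \<alpha>)" "f \<in> Arr C" "Dom C f = base C p (src \<alpha>)" by auto
    have "onArr F (cls \<alpha>) = pushArr K f (interp_obj (src \<alpha>)) \<cdot>\<^bsub>E\<^esub> onArr F (cls (LP f g \<alpha>))"
      using cls_LP[OF LP.prems] F_comp[OF composable_push[OF LP.prems]] F_push[OF f] obj[OF f(1)]
      by simp
    then have "interp (LP f g \<alpha>) = onArr F (cls (LP f g \<alpha>))"
      using LP F_cls[OF LP.prems] F_over[OF LP.prems] obj[OF is_formula_src[OF LP.prems]]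
      by (intro interp_LP_eqI) auto
    then show ?case by simp
  next
    case (RP f \<alpha>)
    then have f: "is_formula (tgt \<alpha>)" "f \<in> Arr C" "Dom C f = base C p (tgt \<alpha>)" by auto
    show ?case
      using RP cls_RP[OF RP.prems] F_comp[of \<alpha> "RP f (id_deriv D C (tgt \<alpha>))"] F_push[OF f]
        obj[OF f(1)]
      by (simp add: composable_def)
  next
    case (LM g \<alpha>)
    then have g: "is_formula (src \<alpha>)" "g \<in> Arr C" "Cod C g = base C p (src \<alpha>)" by auto
    show ?case
      using LM cls_LM[OF LM.prems] F_comp[of "LM g (id_deriv D C (src \<alpha>))" \<alpha>] F_pull[OF g]
        obj[OF g(1)]
      by (simp add: composable_def)
  next
    case (RM f g \<alpha>)
    then have g: "is_formula (tgt \<alpha>)" "g \<in> Arr C" "Cod C g = base C p (tgt \<alpha>)" by auto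
    have "onArr F (cls \<alpha>) = onArr F (cls (RM f g \<alpha>)) \<cdot>\<^bsub>E\<^esub> pullArr K g (interp_obj (tgt \<alpha>))"
      using cls_RM[OF RM.prems] F_comp[OF composable_pull[OF RM.prems]] F_pull[OF g] obj[OF g(1)]
      by simp
    then have "interp (RM f g \<alpha>) = onArr F (cls (RM f g \<alpha>))"
      using RM F_cls[OF RM.prems] F_over[OF RM.prems] obj[OF is_formula_tgt[OF RM.prems]]
      by (intro interp_RM_eqI) auto
    then show ?case by simp
  qed
  show ?thesis using obj arr by (auto simp: functor_eq_def)
qed

end


theorem theorem1p17:
  fixes D :: "('x, 'd) cat" and C :: "('o, 'a) cat" and p :: "('x, 'd, 'o, 'a) functr"
  assumes "cat_functor D C p"
  shows "category (Bif D C p)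
    \<and> bifibration (Bif D C p) C (Lambda C p) (Bif_cleavage D C p)
    \<and> cat_functor D (Bif D C p) (eta D C p)
    \<and> functor_eq D (functor_comp (Lambda C p) (eta D C p)) p
    \<and> (\<forall>(E :: ('y, 'e) cat) (q :: ('y, 'e, 'o, 'a) functr) (K :: ('y, 'e, 'a) cleavage)
          (\<theta> :: ('x, 'd, 'y, 'e) functr).
        bifibration E C q K \<and> cat_functor D E \<theta> \<and> functor_eq D (functor_comp q \<theta>) p \<longrightarrow>
        (\<exists>F :: (('x, 'a) formula, ('x, 'd, 'a) bif_arrow, 'y, 'e) functr.
          (bifibration_morphism (Bif D C p) E C (Lambda C p) (Bif_cleavage D C p) q K F
            \<and> functor_eq D (functor_comp F (eta D C p)) \<theta>)
          \<and> (\<forall>F'. bifibration_morphism (Bif D C p) E C (Lambda C p) (Bif_cleavage D C p) q K F'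
              \<and> functor_eq D (functor_comp F' (eta D C p)) \<theta>
              \<longrightarrow> functor_eq (Bif D C p) F' F)))"
proof -
  interpret sequent_calculus D C p
    using assms by (simp add: sequent_calculus_def)
  show ?thesis
  proof (intro conjI allI impI)
    fix E :: "('y, 'e) cat" and q :: "('y, 'e, 'o, 'a) functr" and K :: "('y, 'e, 'a) cleavage"
      and \<theta> :: "('x, 'd, 'y, 'e) functr"
    assume "bifibration E C q K \<and> cat_functor D E \<theta> \<and> functor_eq D (functor_comp q \<theta>) p"
    then interpret sequent_interpretation D C p E q K \<theta>
      by (simp add: sequent_interpretation_def sequent_interpretation_axioms_def
          sequent_calculus_axioms)
    show "\<exists>F :: (('x, 'a) formula, ('x, 'd, 'a) bif_arrow, 'y, 'e) functr.
        (bifibration_morphism (Bif D C p) E C (Lambda C p) (Bif_cleavage D C p) q K F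
          \<and> functor_eq D (functor_comp F (eta D C p)) \<theta>)
        \<and> (\<forall>F'. bifibration_morphism (Bif D C p) E C (Lambda C p) (Bif_cleavage D C p) q K F'
            \<and> functor_eq D (functor_comp F' (eta D C p)) \<theta>
            \<longrightarrow> functor_eq (Bif D C p) F' F)"
      using bifibration_morphism_interp interp_functor_eta interp_functor_unique by blast
  qed (rule category_Bif bifibration_Bif cat_functor_eta Lambda_eta)+
qed

end
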